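(* Let $G$ be a discrete group with property (BP) and let $\sigma\in Z^2(G,\mathbb{T})$. Then $(G,\sigma)$ has the unique trace property. Moreover, $G$ is ICC and belongs to $\mathcal{K}_{UT}$.
   Context: A group $G$ has property (BP) if for every $g\in G\setminus\{e\}$ and every integer $n\ge2$ there exist $g_1,\dots,g_n\in G$, a subgroup $H$ of $G$, and pairwise disjoint nonempty subsets $T_1,\dots,T_n\subset H$ such that $g_jgg_j^{-1}(H\setminus T_j)\subset T_j$ for all $j=1,\dots,n$. For a discrete group $G$ with identity $e$, $Z^2(G,\mathbb{T})$ is the set of normalized 2-cocycles, i.e. maps $\sigma:G\times G\to\mathbb{T}$ with $\sigma(g,e)=\sigma(e,g)=1$ and $\sigma(g,h)\sigma(gh,k)=\sigma(h,k)\sigma(g,hk)$ for all $g,h,k$. With $(\lambda_\sigma(g)\xi)(h)=\sigma(g,g^{-1}h)\xi(g^{-1}h)$ on $\ell^2(G)$, $C_r^*(G,\sigma)$ is the C$^*$-algebra generated by $\lambda_\sigma(G)$. $(G,\sigma)$ has the unique trace property if $C_r^*(G,\sigma)$ has a unique tracial state. $G$ is ICC if every nontrivial conjugacy class of $G$ is infinite. An element $g\in G$ is $\sigma$-regular if $\sigma(g,h)=\sigma(h,g)$ whenever $h\in G$ commutes with $g$; $(G,\sigma)$ satisfies Kleppner's condition if every nontrivial $\sigma$-regular conjugacy class of $G$ is infinite. $\mathcal{K}_{UT}$ is the class of groups $G$ such that, for all $\sigma\in Z^2(G,\mathbb{T})$, $(G,\sigma)$ has the unique trace property if and only if it satisfies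 Kleppner's condition. *)

theory Defs
  imports "HOL-Analysis.Analysis" "HOL-Algebra.Coset"
begin

section \<open>Bounded operators on the Hilbert space of square-summable functions on a set\<close>

text \<open>
  Vectors are functions on the whole type that vanish outside the index set, and operators are
  functions on all vectors that vanish outside the Hilbert space.  With this convention two
  operators are equal in HOL iff they agree on the Hilbert space, and sums, scalar multiples and
  products of operators are the pointwise ones and plain composition.
\<close>

definition ell2 :: "'a set \<Rightarrow> ('a \<Rightarrow> complex) set" where
  "ell2 X = {\<xi>. (\<forall>x. x \<notin> X \<longrightarrow> \<xi> x = 0) \<and> (\<lambda>x. (cmod (\<xi> x))\<^sup>2) summable_on X}"

definition ell2_inner :: "'a set \<Rightarrow> ('a \<Rightarrow> complex) \<Rightarrow> ('a \<Rightarrow> complex) \<Rightarrow> complex" where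
  "ell2_inner X \<xi> \<eta> = (\<Sum>\<^sub>\<infinity>x\<in>X. \<xi> x * cnj (\<eta> x))"

definition ell2_norm :: "'a set \<Rightarrow> ('a \<Rightarrow> complex) \<Rightarrow> real" where
  "ell2_norm X \<xi> = sqrt (\<Sum>\<^sub>\<infinity>x\<in>X. (cmod (\<xi> x))\<^sup>2)"

type_synonym 'a operator = "('a \<Rightarrow> complex) \<Rightarrow> ('a \<Rightarrow> complex)"

definition op_zero :: "'a operator" where
  "op_zero = (\<lambda>\<xi> x. 0)"

definition op_add :: "'a operator \<Rightarrow> 'a operator \<Rightarrow> 'a operator" where
  "op_add S T = (\<lambda>\<xi> x. S \<xi> x + T \<xi> x)"

definition op_diff :: "'a operator \<Rightarrow> 'a operator \<Rightarrow> 'a operator" where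
  "op_diff S T = (\<lambda>\<xi> x. S \<xi> x - T \<xi> x)"

definition op_scale :: "complex \<Rightarrow> 'a operator \<Rightarrow> 'a operator" where
  "op_scale c T = (\<lambda>\<xi> x. c * T \<xi> x)"

definition bounded_ops :: "'a set \<Rightarrow> 'a operator set" where
  "bounded_ops X = {T.
     (\<forall>\<xi>\<in>ell2 X. T \<xi> \<in> ell2 X) \<and>
     (\<forall>\<xi>. \<xi> \<notin> ell2 X \<longrightarrow> T \<xi> = (\<lambda>x. 0)) \<and>
     (\<forall>\<xi>\<in>ell2 X. \<forall>\<eta>\<in>ell2 X. T (\<lambda>x. \<xi> x + \<eta> x) = (\<lambda>x. T \<xi> x + T \<eta> x)) \<and>
     (\<forall>c. \<forall>\<xi>\<in>ell2 X. T (\<lambda>x. c * \<xi> x) = (\<lambda>x. c * T \<xi> x)) \<and>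
     (\<exists>K. \<forall>\<xi>\<in>ell2 X. ell2_norm X (T \<xi>) \<le> K * ell2_norm X \<xi>)}"

definition op_norm :: "'a set \<Rightarrow> 'a operator \<Rightarrow> real" where
  "op_norm X T = (SUP \<xi>\<in>{\<xi>\<in>ell2 X. ell2_norm X \<xi> \<le> 1}. ell2_norm X (T \<xi>))"

definition is_adjoint :: "'a set \<Rightarrow> 'a operator \<Rightarrow> 'a operator \<Rightarrow> bool" where
  "is_adjoint X T S \<longleftrightarrow> T \<in> bounded_ops X \<and> S \<in> bounded_ops X \<and>
     (\<forall>\<xi>\<in>ell2 X. \<forall>\<eta>\<in>ell2 X. ell2_inner X (T \<xi>) \<eta> = ell2_inner X \<xi> (S \<eta>))"


section \<open>Concrete C*-algebras and tracial states\<close>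

definition concrete_cstar_algebra :: "'a set \<Rightarrow> 'a operator set \<Rightarrow> bool" where
  "concrete_cstar_algebra X A \<longleftrightarrow>
     A \<subseteq> bounded_ops X \<and>
     op_zero \<in> A \<and>
     (\<forall>S\<in>A. \<forall>T\<in>A. op_add S T \<in> A) \<and>
     (\<forall>c. \<forall>T\<in>A. op_scale c T \<in> A) \<and>
     (\<forall>S\<in>A. \<forall>T\<in>A. S \<circ> T \<in> A) \<and>
     (\<forall>T\<in>A. \<exists>S\<in>A. is_adjoint X T S) \<and>
     (\<forall>T\<in>bounded_ops X. (\<forall>\<epsilon>>0. \<exists>S\<in>A. op_norm X (op_diff T S) < \<epsilon>) \<longrightarrow> T \<in> A)"

definition cstar_generated :: "'a set \<Rightarrow> 'a operator set \<Rightarrow> 'a operator set" where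
  "cstar_generated X B = \<Inter>{A. concrete_cstar_algebra X A \<and> B \<subseteq> A}"

text \<open>
  A state is a positive linear functional of norm one.  Extensionality makes a functional on
  \<open>A\<close> unique as a HOL function; the boundedness clause is needed because the supremum of an
  unbounded set of reals is unspecified.
\<close>

definition cstar_state :: "'a set \<Rightarrow> 'a operator set \<Rightarrow> ('a operator \<Rightarrow> complex) \<Rightarrow> bool" where
  "cstar_state X A \<phi> \<longleftrightarrow>
     \<phi> \<in> extensional A \<and>
     (\<forall>S\<in>A. \<forall>T\<in>A. \<phi> (op_add S T) = \<phi> S + \<phi> T) \<and>
     (\<forall>c. \<forall>T\<in>A. \<phi> (op_scale c T) = c * \<phi> T) \<and>
     (\<forall>T\<in>A. \<forall>S\<in>A. is_adjoint X T S \<longrightarrow> \<phi> (S \<circ> T) \<in> \<real>\<^sub>\<ge>\<^sub>0) \<and>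
     bdd_above ((\<lambda>T. cmod (\<phi> T)) ` {T\<in>A. op_norm X T \<le> 1}) \<and>
     (SUP T\<in>{T\<in>A. op_norm X T \<le> 1}. cmod (\<phi> T)) = 1"

definition tracial_state :: "'a set \<Rightarrow> 'a operator set \<Rightarrow> ('a operator \<Rightarrow> complex) \<Rightarrow> bool" where
  "tracial_state X A \<phi> \<longleftrightarrow> cstar_state X A \<phi> \<and> (\<forall>S\<in>A. \<forall>T\<in>A. \<phi> (S \<circ> T) = \<phi> (T \<circ> S))"


section \<open>Twisted group C*-algebras\<close>

text \<open>
  Only the values of a cocycle on the carrier are constrained, and only these values enter
  the definitions below.
\<close>

definition cocycles2 :: "('a, 'b) monoid_scheme \<Rightarrow> ('a \<Rightarrow> 'a \<Rightarrow> complex) set" where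
  "cocycles2 G = {\<sigma>.
     (\<forall>g\<in>carrier G. \<forall>h\<in>carrier G. cmod (\<sigma> g h) = 1) \<and>
     (\<forall>g\<in>carrier G. \<sigma> g \<one>\<^bsub>G\<^esub> = 1 \<and> \<sigma> \<one>\<^bsub>G\<^esub> g = 1) \<and>
     (\<forall>g\<in>carrier G. \<forall>h\<in>carrier G. \<forall>k\<in>carrier G.
        \<sigma> g h * \<sigma> (g \<otimes>\<^bsub>G\<^esub> h) k = \<sigma> h k * \<sigma> g (h \<otimes>\<^bsub>G\<^esub> k))}"

definition twisted_regular ::
    "('a, 'b) monoid_scheme \<Rightarrow> ('a \<Rightarrow> 'a \<Rightarrow> complex) \<Rightarrow> 'a \<Rightarrow> 'a operator" where
  "twisted_regular G \<sigma> g = (\<lambda>\<xi> h.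
     if \<xi> \<in> ell2 (carrier G) \<and> h \<in> carrier G
     then \<sigma> g (inv\<^bsub>G\<^esub> g \<otimes>\<^bsub>G\<^esub> h) * \<xi> (inv\<^bsub>G\<^esub> g \<otimes>\<^bsub>G\<^esub> h) else 0)"

definition reduced_twisted_cstar ::
    "('a, 'b) monoid_scheme \<Rightarrow> ('a \<Rightarrow> 'a \<Rightarrow> complex) \<Rightarrow> 'a operator set" where
  "reduced_twisted_cstar G \<sigma> =
     cstar_generated (carrier G) (twisted_regular G \<sigma> ` carrier G)"

definition unique_trace_property ::
    "('a, 'b) monoid_scheme \<Rightarrow> ('a \<Rightarrow> 'a \<Rightarrow> complex) \<Rightarrow> bool" where
  "unique_trace_property G \<sigma> \<longleftrightarrow>
     (\<exists>!\<phi>. tracial_state (carrier G) (reduced_twisted_cstar G \<sigma>) \<phi>)"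


section \<open>Conditions on groups\<close>

definition conjugacy_class :: "('a, 'b) monoid_scheme \<Rightarrow> 'a \<Rightarrow> 'a set" where
  "conjugacy_class G g = (\<lambda>x. x \<otimes>\<^bsub>G\<^esub> g \<otimes>\<^bsub>G\<^esub> inv\<^bsub>G\<^esub> x) ` carrier G"

definition ICC :: "('a, 'b) monoid_scheme \<Rightarrow> bool" where
  "ICC G \<longleftrightarrow> (\<forall>g\<in>carrier G - {\<one>\<^bsub>G\<^esub>}. infinite (conjugacy_class G g))"

definition sigma_regular ::
    "('a, 'b) monoid_scheme \<Rightarrow> ('a \<Rightarrow> 'a \<Rightarrow> complex) \<Rightarrow> 'a \<Rightarrow> bool" where
  "sigma_regular G \<sigma> g \<longleftrightarrow>
     (\<forall>h\<in>carrier G. h \<otimes>\<^bsub>G\<^esub> g = g \<otimes>\<^bsub>G\<^esub> h \<longrightarrow> \<sigma> g h = \<sigma> h g)"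

text \<open>
  For a cocycle on a group, regularity is invariant under conjugation, so a regular conjugacy
  class is the class of a regular element.
\<close>

definition kleppner_condition ::
    "('a, 'b) monoid_scheme \<Rightarrow> ('a \<Rightarrow> 'a \<Rightarrow> complex) \<Rightarrow> bool" where
  "kleppner_condition G \<sigma> \<longleftrightarrow>
     (\<forall>g\<in>carrier G - {\<one>\<^bsub>G\<^esub>}. sigma_regular G \<sigma> g \<longrightarrow> infinite (conjugacy_class G g))"

definition class_K_UT :: "('a, 'b) monoid_scheme \<Rightarrow> bool" where
  "class_K_UT G \<longleftrightarrow> group G \<and>
     (\<forall>\<sigma>\<in>cocycles2 G. unique_trace_property G \<sigma> \<longleftrightarrow> kleppner_condition G \<sigma>)"

definition property_BP :: "('a, 'b) monoid_scheme \<Rightarrow> bool" where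
  "property_BP G \<longleftrightarrow>
     (\<forall>g\<in>carrier G - {\<one>\<^bsub>G\<^esub>}. \<forall>n::nat. n \<ge> 2 \<longrightarrow>
        (\<exists>(x :: nat \<Rightarrow> 'a) H (T :: nat \<Rightarrow> 'a set).
           x ` {1..n} \<subseteq> carrier G \<and> subgroup H G \<and>
           disjoint_family_on T {1..n} \<and>
           (\<forall>j\<in>{1..n}. T j \<noteq> {} \<and> T j \<subseteq> H \<and>
              (x j \<otimes>\<^bsub>G\<^esub> g \<otimes>\<^bsub>G\<^esub> inv\<^bsub>G\<^esub> x j) <#\<^bsub>G\<^esub> (H - T j) \<subseteq> T j)))"

end

theory Submission
  imports Defs
begin

text \<open>
  Let \<open>\<phi>\<close> be a tracial state on the reduced twisted group C*-algebra, write \<open>lam\<close> for the twisted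
  regular representation, and let \<open>g \<noteq> \<one>\<close>.  Conjugating by \<open>lam x\<close> changes \<open>lam g\<close> into a unimodular
  multiple of \<open>lam (x \<otimes> g \<otimes> inv x)\<close>, so \<open>n * \<phi> (lam g)\<close> is the value of \<open>\<phi>\<close> at a sum of unimodular
  multiples of \<open>lam (y j)\<close> for any \<open>n\<close> conjugates \<open>y j\<close> of \<open>g\<close> (\<open>trace_conjugate\<close>).  For the conjugates
  provided by property (BP), each \<open>y j\<close> maps the complement of a set \<open>S j\<close> into \<open>S j\<close>, with the sets
  \<open>S j\<close> pairwise disjoint.  This ping-pong makes the summands nearly orthogonal, and the norm of the
  sum is at most \<open>2 * sqrt n\<close> (\<open>ping_pong_sum_bound\<close>).  Hence \<open>\<phi> (lam g)\<close> is bounded by \<open>2 / sqrt n\<close>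
  for every \<open>n\<close> and vanishes.  Only absolute values of vectors enter the estimate, which is why the
  cocycle is arbitrary.

  The linear span of the operators \<open>lam g\<close> is closed under products and adjoints, hence dense in the
  algebra (\<open>cstar_generated_eq_closure_span\<close>), so \<open>\<phi>\<close> is a multiple of the canonical trace, given
  by the matrix coefficient at the unit vector at \<open>\<one>\<close>.  The normalisation of states makes the
  multiple one, and the canonical trace is a tracial state for every group and cocycle
  (\<open>canonical_trace_tracial\<close>).

  For \<open>n \<ge> 3\<close> the ping-pong conjugates \<open>y j\<close> are pairwise distinct, so conjugacy classes of
  nontrivial elements are infinite.  An ICC group satisfies Kleppner's condition for every cocycle, so
  both sides of the equivalence defining the class hold throughout.
\<close>

section \<open>The Hilbert space of square-summable functions\<close>

lemma ell2_norm_nonneg [simp]: "0 \<le> ell2_norm X \<xi>"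
  by (simp add: ell2_norm_def infsum_nonneg)

lemma ell2_outside: "\<xi> \<in> ell2 X \<Longrightarrow> x \<notin> X \<Longrightarrow> \<xi> x = 0"
  by (auto simp: ell2_def)

lemma L2_set_le_ell2_norm:
  assumes "\<xi> \<in> ell2 X" "finite F" "F \<subseteq> X"
  shows "L2_set (\<lambda>x. cmod (\<xi> x)) F \<le> ell2_norm X \<xi>"
  unfolding L2_set_def ell2_norm_def
  by (rule real_sqrt_le_mono, rule finite_sum_le_infsum) (use assms in \<open>auto simp: ell2_def\<close>)

lemma sum_squares_le_ell2_norm:
  assumes "\<xi> \<in> ell2 X" "finite F" "F \<subseteq> X"
  shows "(\<Sum>x\<in>F. (cmod (\<xi> x))\<^sup>2) \<le> (ell2_norm X \<xi>)\<^sup>2"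
proof -
  have "(L2_set (\<lambda>x. cmod (\<xi> x)) F)\<^sup>2 \<le> (ell2_norm X \<xi>)\<^sup>2"
    using L2_set_le_ell2_norm[OF assms] by (intro power_mono) auto
  then show ?thesis by (simp add: L2_set_def sum_nonneg)
qed

text \<open>
  Membership and norm bounds are read off from finite subsets of the index set, so that the finite
  Minkowski and Cauchy-Schwarz inequalities carry over to the whole space.
\<close>

lemma ell2_norm_leI:
  assumes "\<And>x. x \<notin> X \<Longrightarrow> \<xi> x = 0"
    and "\<And>F. finite F \<Longrightarrow> F \<subseteq> X \<Longrightarrow> L2_set (\<lambda>x. cmod (\<xi> x)) F \<le> r"
  shows "\<xi> \<in> ell2 X" and "ell2_norm X \<xi> \<le> r"
proof -
  have r: "0 \<le> r" using assms(2)[of "{}"] by simp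
  have le: "(\<Sum>x\<in>F. (cmod (\<xi> x))\<^sup>2) \<le> r\<^sup>2" if "finite F" "F \<subseteq> X" for F
  proof -
    have "(L2_set (\<lambda>x. cmod (\<xi> x)) F)\<^sup>2 \<le> r\<^sup>2"
      using assms(2)[OF that] by (intro power_mono) auto
    then show ?thesis by (simp add: L2_set_def sum_nonneg)
  qed
  have summ: "(\<lambda>x. (cmod (\<xi> x))\<^sup>2) summable_on X"
    by (rule nonneg_bdd_above_summable_on) (auto intro!: bdd_aboveI2[where M = "r\<^sup>2"] le)
  then show "\<xi> \<in> ell2 X" using assms(1) by (auto simp: ell2_def)
  have "(\<Sum>\<^sub>\<infinity>x\<in>X. (cmod (\<xi> x))\<^sup>2) \<le> r\<^sup>2"
    by (rule infsum_le_finite_sums[OF summ le])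
  then show "ell2_norm X \<xi> \<le> r"
    unfolding ell2_norm_def using r by (metis real_sqrt_le_mono real_sqrt_unique)
qed

lemma
  assumes "\<xi> \<in> ell2 X" "\<eta> \<in> ell2 X"
  shows ell2_add: "(\<lambda>x. \<xi> x + \<eta> x) \<in> ell2 X"
    and ell2_norm_triangle: "ell2_norm X (\<lambda>x. \<xi> x + \<eta> x) \<le> ell2_norm X \<xi> + ell2_norm X \<eta>"
proof -
  have "L2_set (\<lambda>x. cmod (\<xi> x + \<eta> x)) F \<le> ell2_norm X \<xi> + ell2_norm X \<eta>"
    if F: "finite F" "F \<subseteq> X" for F
  proof -
    have "L2_set (\<lambda>x. cmod (\<xi> x + \<eta> x)) F \<le> L2_set (\<lambda>x. cmod (\<xi> x) + cmod (\<eta> x)) F"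
      by (rule L2_set_mono) (auto intro: norm_triangle_ineq)
    also have "\<dots> \<le> L2_set (\<lambda>x. cmod (\<xi> x)) F + L2_set (\<lambda>x. cmod (\<eta> x)) F"
      by (rule L2_set_triangle_ineq)
    also have "\<dots> \<le> ell2_norm X \<xi> + ell2_norm X \<eta>"
      using assms F by (intro add_mono L2_set_le_ell2_norm)
    finally show ?thesis .
  qed
  note * = this
  show "(\<lambda>x. \<xi> x + \<eta> x) \<in> ell2 X"
    by (rule ell2_norm_leI(1)[OF _ *]) (use assms in \<open>auto simp: ell2_outside\<close>)
  show "ell2_norm X (\<lambda>x. \<xi> x + \<eta> x) \<le> ell2_norm X \<xi> + ell2_norm X \<eta>"
    by (rule ell2_norm_leI(2)[OF _ *]) (use assms in \<open>auto simp: ell2_outside\<close>)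
qed

lemma
  assumes "\<xi> \<in> ell2 X"
  shows ell2_scale: "(\<lambda>x. c * \<xi> x) \<in> ell2 X"
    and ell2_norm_scale_le: "ell2_norm X (\<lambda>x. c * \<xi> x) \<le> cmod c * ell2_norm X \<xi>"
proof -
  have *: "L2_set (\<lambda>x. cmod (c * \<xi> x)) F \<le> cmod c * ell2_norm X \<xi>"
    if F: "finite F" "F \<subseteq> X" for F
    using L2_set_le_ell2_norm[OF assms F]
    by (simp add: norm_mult mult_left_mono flip: L2_set_right_distrib)
  show "(\<lambda>x. c * \<xi> x) \<in> ell2 X"
    by (rule ell2_norm_leI(1)[OF _ *]) (use assms in \<open>auto simp: ell2_outside\<close>)
  show "ell2_norm X (\<lambda>x. c * \<xi> x) \<le> cmod c * ell2_norm X \<xi>"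
    by (rule ell2_norm_leI(2)[OF _ *]) (use assms in \<open>auto simp: ell2_outside\<close>)
qed

lemma ell2_zero [simp]: "(\<lambda>x. 0) \<in> ell2 X"
  by (simp add: ell2_def)

lemma ell2_norm_zero [simp]: "ell2_norm X (\<lambda>x. 0) = 0"
  by (simp add: ell2_norm_def)

lemma ell2_diff: "\<xi> \<in> ell2 X \<Longrightarrow> \<eta> \<in> ell2 X \<Longrightarrow> (\<lambda>x. \<xi> x - \<eta> x) \<in> ell2 X"
  using ell2_add[of \<xi> X "\<lambda>x. -1 * \<eta> x"] ell2_scale[of \<eta> X "-1"] by simp

lemma cmod_le_ell2_norm: "\<xi> \<in> ell2 X \<Longrightarrow> cmod (\<xi> x) \<le> ell2_norm X \<xi>"
  using L2_set_le_ell2_norm[of \<xi> X "{x}"] by (cases "x \<in> X") (auto simp: ell2_outside)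

lemma ell2_inner_abs_summable:
  assumes "\<xi> \<in> ell2 X" "\<eta> \<in> ell2 X"
  shows "(\<lambda>x. norm (\<xi> x * cnj (\<eta> x))) summable_on X"
    and "(\<Sum>\<^sub>\<infinity>x\<in>X. norm (\<xi> x * cnj (\<eta> x))) \<le> ell2_norm X \<xi> * ell2_norm X \<eta>"
proof -
  have *: "(\<Sum>x\<in>F. norm (\<xi> x * cnj (\<eta> x))) \<le> ell2_norm X \<xi> * ell2_norm X \<eta>"
    if F: "finite F" "F \<subseteq> X" for F
  proof -
    have "(\<Sum>x\<in>F. norm (\<xi> x * cnj (\<eta> x))) = (\<Sum>x\<in>F. \<bar>cmod (\<xi> x)\<bar> * \<bar>cmod (\<eta> x)\<bar>)"
      by (simp add: norm_mult)
    also have "\<dots> \<le> L2_set (\<lambda>x. cmod (\<xi> x)) F * L2_set (\<lambda>x. cmod (\<eta> x)) F"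
      by (rule L2_set_mult_ineq)
    also have "\<dots> \<le> ell2_norm X \<xi> * ell2_norm X \<eta>"
      using assms F by (intro mult_mono L2_set_le_ell2_norm) auto
    finally show ?thesis .
  qed
  show "(\<lambda>x. norm (\<xi> x * cnj (\<eta> x))) summable_on X"
    unfolding abs_summable_iff_bdd_above by (rule bdd_aboveI2) (use * in auto)
  then show "(\<Sum>\<^sub>\<infinity>x\<in>X. norm (\<xi> x * cnj (\<eta> x))) \<le> ell2_norm X \<xi> * ell2_norm X \<eta>"
    by (rule infsum_le_finite_sums) (rule *)
qed

lemmas ell2_inner_summable = abs_summable_summable[OF ell2_inner_abs_summable(1)]

lemma ell2_Cauchy_Schwarz:
  assumes "\<xi> \<in> ell2 X" "\<eta> \<in> ell2 X"
  shows "cmod (ell2_inner X \<xi> \<eta>) \<le> ell2_norm X \<xi> * ell2_norm X \<eta>"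
  unfolding ell2_inner_def
  using norm_infsum_bound[OF ell2_inner_abs_summable(1)[OF assms]]
    ell2_inner_abs_summable(2)[OF assms] by linarith

lemma ell2_inner_add_left:
  assumes "\<xi> \<in> ell2 X" "\<xi>' \<in> ell2 X" "\<eta> \<in> ell2 X"
  shows "ell2_inner X (\<lambda>x. \<xi> x + \<xi>' x) \<eta> = ell2_inner X \<xi> \<eta> + ell2_inner X \<xi>' \<eta>"
  unfolding ell2_inner_def using assms
  by (simp add: distrib_right infsum_add ell2_inner_summable)

lemma ell2_inner_scale_left: "ell2_inner X (\<lambda>x. c * \<xi> x) \<eta> = c * ell2_inner X \<xi> \<eta>"
  unfolding ell2_inner_def by (simp add: mult.assoc infsum_cmult_right')

lemma ell2_inner_diff_left:
  assumes "\<xi> \<in> ell2 X" "\<xi>' \<in> ell2 X" "\<eta> \<in> ell2 X"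
  shows "ell2_inner X (\<lambda>x. \<xi> x - \<xi>' x) \<eta> = ell2_inner X \<xi> \<eta> - ell2_inner X \<xi>' \<eta>"
  using ell2_inner_add_left[of \<xi> X "\<lambda>x. -1 * \<xi>' x" \<eta>] ell2_inner_scale_left[of X "-1" \<xi>' \<eta>]
    ell2_scale[of \<xi>' X "-1"] assms by simp

lemma ell2_inner_commute: "ell2_inner X \<eta> \<xi> = cnj (ell2_inner X \<xi> \<eta>)"
  unfolding ell2_inner_def by (simp add: mult.commute flip: infsum_cnj)

lemma ell2_inner_add_right:
  assumes "\<xi> \<in> ell2 X" "\<eta> \<in> ell2 X" "\<eta>' \<in> ell2 X"
  shows "ell2_inner X \<xi> (\<lambda>x. \<eta> x + \<eta>' x) = ell2_inner X \<xi> \<eta> + ell2_inner X \<xi> \<eta>'"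
  using ell2_inner_add_left[of \<eta> X \<eta>' \<xi>] assms by (subst (1 2 3) ell2_inner_commute) simp

lemma ell2_inner_scale_right: "ell2_inner X \<xi> (\<lambda>x. c * \<eta> x) = cnj c * ell2_inner X \<xi> \<eta>"
  by (subst (1 2) ell2_inner_commute) (simp add: ell2_inner_scale_left)

lemma ell2_inner_self:
  assumes "\<xi> \<in> ell2 X"
  shows "ell2_inner X \<xi> \<xi> = of_real ((ell2_norm X \<xi>)\<^sup>2)"
proof -
  have "ell2_inner X \<xi> \<xi> = (\<Sum>\<^sub>\<infinity>x\<in>X. of_real ((cmod (\<xi> x))\<^sup>2))"
    unfolding ell2_inner_def by (simp only: complex_norm_square)
  also have "\<dots> = of_real (\<Sum>\<^sub>\<infinity>x\<in>X. (cmod (\<xi> x))\<^sup>2)"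
    by (rule infsumI, rule has_sum_of_real, rule has_sum_infsum) (use assms in \<open>simp add: ell2_def\<close>)
  finally show ?thesis by (simp add: ell2_norm_def infsum_nonneg)
qed

definition point_mass :: "'a \<Rightarrow> 'a \<Rightarrow> complex" where
  "point_mass x = (\<lambda>y. if y = x then 1 else 0)"

definition truncate :: "'a set \<Rightarrow> ('a \<Rightarrow> complex) \<Rightarrow> 'a \<Rightarrow> complex" where
  "truncate F \<xi> = (\<lambda>x. if x \<in> F then \<xi> x else 0)"

lemma
  assumes "finite F" "F \<subseteq> X"
  shows truncate_ell2: "truncate F \<xi> \<in> ell2 X"
    and ell2_norm_truncate_le: "ell2_norm X (truncate F \<xi>) \<le> L2_set (\<lambda>x. cmod (\<xi> x)) F"
proof -
  have *: "L2_set (\<lambda>x. cmod (truncate F \<xi> x)) F' \<le> L2_set (\<lambda>x. cmod (\<xi> x)) F"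
    if F': "finite F'" "F' \<subseteq> X" for F'
  proof -
    have "(\<Sum>x\<in>F'. (cmod (truncate F \<xi> x))\<^sup>2) = (\<Sum>x\<in>F' \<inter> F. (cmod (\<xi> x))\<^sup>2)"
      by (rule sum.mono_neutral_cong_right) (auto simp: truncate_def F')
    also have "\<dots> \<le> (\<Sum>x\<in>F. (cmod (\<xi> x))\<^sup>2)"
      by (rule sum_mono2) (use assms in auto)
    finally show ?thesis by (simp add: L2_set_def)
  qed
  show "truncate F \<xi> \<in> ell2 X"
    by (rule ell2_norm_leI(1)[OF _ *]) (use assms in \<open>auto simp: truncate_def\<close>)
  show "ell2_norm X (truncate F \<xi>) \<le> L2_set (\<lambda>x. cmod (\<xi> x)) F"
    by (rule ell2_norm_leI(2)[OF _ *]) (use assms in \<open>auto simp: truncate_def\<close>)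
qed

lemma truncate_singleton: "truncate {x} \<xi> = (\<lambda>y. \<xi> x * point_mass x y)"
  by (auto simp: truncate_def point_mass_def)

lemma truncate_insert:
  "x \<notin> F \<Longrightarrow> truncate (insert x F) \<xi> = (\<lambda>y. \<xi> x * point_mass x y + truncate F \<xi> y)"
  by (auto simp: truncate_def point_mass_def)

lemma
  assumes "x \<in> X"
  shows point_mass_ell2: "point_mass x \<in> ell2 X"
    and ell2_norm_point_mass_le: "ell2_norm X (point_mass x) \<le> 1"
  using truncate_ell2[of "{x}" X "\<lambda>_. 1"] ell2_norm_truncate_le[of "{x}" X "\<lambda>_. 1"] assms
  by (auto simp: truncate_singleton)

lemma ell2_inner_point_mass_left:
  assumes "x \<in> X"
  shows "ell2_inner X (point_mass x) \<eta> = cnj (\<eta> x)"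
proof -
  have "ell2_inner X (point_mass x) \<eta> = (\<Sum>\<^sub>\<infinity>y\<in>{x}. cnj (\<eta> y))"
    unfolding ell2_inner_def
    by (rule infsum_cong_neutral) (use assms in \<open>auto simp: point_mass_def\<close>)
  then show ?thesis by simp
qed

lemma truncate_approx:
  assumes "\<xi> \<in> ell2 X" "0 < \<epsilon>"
  shows "\<exists>F. finite F \<and> F \<subseteq> X \<and> ell2_norm X (\<lambda>x. \<xi> x - truncate F \<xi> x) \<le> \<epsilon>"
proof -
  let ?f = "\<lambda>x. (cmod (\<xi> x))\<^sup>2"
  have summ: "?f summable_on X" using assms by (simp add: ell2_def)
  obtain F where F: "finite F" "F \<subseteq> X" "dist (sum ?f F) (infsum ?f X) \<le> \<epsilon>\<^sup>2"
    using infsum_finite_approximation[OF summ, of "\<epsilon>\<^sup>2"] assms by auto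
  have "L2_set (\<lambda>x. cmod (\<xi> x - truncate F \<xi> x)) F' \<le> \<epsilon>" if F': "finite F'" "F' \<subseteq> X" for F'
  proof -
    have "(\<Sum>x\<in>F'. (cmod (\<xi> x - truncate F \<xi> x))\<^sup>2) = sum ?f (F' - F)"
      by (rule sum.mono_neutral_cong_right) (auto simp: truncate_def F')
    also have "\<dots> = sum ?f (F' \<union> F) - sum ?f F"
      using F F' by (metis add_diff_cancel_right' sum.union_diff2 sum.union_disjoint
          Diff_disjoint Int_commute Un_Diff_cancel2 finite_Diff)
    also have "\<dots> \<le> infsum ?f X - sum ?f F"
      using finite_sum_le_infsum[OF summ, of "F' \<union> F"] F F' by simp
    also have "\<dots> \<le> \<epsilon>\<^sup>2" using F(3) by (simp add: dist_real_def)
    finally show ?thesis using assms(2) by (simp add: L2_set_def real_le_lsqrt sum_nonneg)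
  qed
  then have "ell2_norm X (\<lambda>x. \<xi> x - truncate F \<xi> x) \<le> \<epsilon>"
    by (rule ell2_norm_leI(2)[rotated]) (use assms(1) in \<open>auto simp: truncate_def ell2_outside\<close>)
  then show ?thesis using F by blast
qed

section \<open>Bounded operators and their adjoints\<close>

lemma bounded_ops_ell2: "T \<in> bounded_ops X \<Longrightarrow> \<xi> \<in> ell2 X \<Longrightarrow> T \<xi> \<in> ell2 X"
  and bounded_ops_outside: "T \<in> bounded_ops X \<Longrightarrow> \<xi> \<notin> ell2 X \<Longrightarrow> T \<xi> = (\<lambda>x. 0)"
  and bounded_ops_add: "T \<in> bounded_ops X \<Longrightarrow> \<xi> \<in> ell2 X \<Longrightarrow> \<eta> \<in> ell2 X \<Longrightarrow>
    T (\<lambda>x. \<xi> x + \<eta> x) = (\<lambda>x. T \<xi> x + T \<eta> x)"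
  and bounded_ops_scale: "T \<in> bounded_ops X \<Longrightarrow> \<xi> \<in> ell2 X \<Longrightarrow>
    T (\<lambda>x. c * \<xi> x) = (\<lambda>x. c * T \<xi> x)"
  by (auto simp: bounded_ops_def)

lemma bounded_ops_zero: "T \<in> bounded_ops X \<Longrightarrow> T (\<lambda>x. 0) = (\<lambda>x. 0)"
  using bounded_ops_scale[of T X "\<lambda>x. 0" 0] by simp

lemma bounded_ops_diff: "T \<in> bounded_ops X \<Longrightarrow> \<xi> \<in> ell2 X \<Longrightarrow> \<eta> \<in> ell2 X \<Longrightarrow>
    T (\<lambda>x. \<xi> x - \<eta> x) = (\<lambda>x. T \<xi> x - T \<eta> x)"
  using bounded_ops_add[of T X \<xi> "\<lambda>x. -1 * \<eta> x"] bounded_ops_scale[of T X \<eta> "-1"]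
    ell2_scale[of \<eta> X "-1"] by simp

lemma bounded_opsI:
  assumes "\<And>\<xi>. \<xi> \<in> ell2 X \<Longrightarrow> T \<xi> \<in> ell2 X"
    and "\<And>\<xi>. \<xi> \<notin> ell2 X \<Longrightarrow> T \<xi> = (\<lambda>x. 0)"
    and "\<And>\<xi> \<eta>. \<xi> \<in> ell2 X \<Longrightarrow> \<eta> \<in> ell2 X \<Longrightarrow> T (\<lambda>x. \<xi> x + \<eta> x) = (\<lambda>x. T \<xi> x + T \<eta> x)"
    and "\<And>c \<xi>. \<xi> \<in> ell2 X \<Longrightarrow> T (\<lambda>x. c * \<xi> x) = (\<lambda>x. c * T \<xi> x)"
    and "\<And>\<xi>. \<xi> \<in> ell2 X \<Longrightarrow> ell2_norm X (T \<xi>) \<le> K * ell2_norm X \<xi>"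
  shows "T \<in> bounded_ops X"
  using assms unfolding bounded_ops_def by blast

lemma op_norm_le:
  assumes "\<And>\<xi>. \<xi> \<in> ell2 X \<Longrightarrow> ell2_norm X (T \<xi>) \<le> K * ell2_norm X \<xi>" "0 \<le> K"
  shows "op_norm X T \<le> K"
  unfolding op_norm_def
proof (rule cSUP_least)
  show "{\<xi> \<in> ell2 X. ell2_norm X \<xi> \<le> 1} \<noteq> {}"
    using ell2_zero[of X] ell2_norm_zero[of X]
    by (metis (mono_tags, lifting) empty_iff mem_Collect_eq zero_le_one)
  fix \<xi> assume "\<xi> \<in> {\<xi> \<in> ell2 X. ell2_norm X \<xi> \<le> 1}"
  then show "ell2_norm X (T \<xi>) \<le> K"
    using assms(1)[of \<xi>] mult_left_le[OF _ assms(2), of "ell2_norm X \<xi>"] by force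
qed

lemma
  assumes "T \<in> bounded_ops X"
  shows op_norm_nonneg: "0 \<le> op_norm X T"
    and op_norm_bound: "\<xi> \<in> ell2 X \<Longrightarrow> ell2_norm X (T \<xi>) \<le> op_norm X T * ell2_norm X \<xi>"
proof -
  obtain K where K: "\<And>\<xi>. \<xi> \<in> ell2 X \<Longrightarrow> ell2_norm X (T \<xi>) \<le> K * ell2_norm X \<xi>"
    using assms unfolding bounded_ops_def by blast
  have "ell2_norm X (T \<xi>) \<le> \<bar>K\<bar>" if "\<xi> \<in> ell2 X" "ell2_norm X \<xi> \<le> 1" for \<xi>
  proof -
    have "ell2_norm X (T \<xi>) \<le> \<bar>K\<bar> * ell2_norm X \<xi>"
      using K[OF that(1)] by (meson abs_ge_self ell2_norm_nonneg mult_right_mono order_trans)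
    also have "\<dots> \<le> \<bar>K\<bar>" using that(2) by (simp add: mult_left_le)
    finally show ?thesis .
  qed
  then have bdd: "bdd_above ((\<lambda>\<xi>. ell2_norm X (T \<xi>)) ` {\<xi> \<in> ell2 X. ell2_norm X \<xi> \<le> 1})"
    by (intro bdd_aboveI2) auto
  have unit: "ell2_norm X (T \<xi>) \<le> op_norm X T" if "\<xi> \<in> ell2 X" "ell2_norm X \<xi> \<le> 1" for \<xi>
    unfolding op_norm_def by (rule cSUP_upper[OF _ bdd]) (use that in simp)
  show "0 \<le> op_norm X T"
    using order_trans[OF ell2_norm_nonneg unit[of "\<lambda>x. 0"]] by simp
  show "ell2_norm X (T \<xi>) \<le> op_norm X T * ell2_norm X \<xi>" if \<xi>: "\<xi> \<in> ell2 X"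
  proof (cases "ell2_norm X \<xi> = 0")
    case True
    then show ?thesis using K[OF \<xi>] by simp
  next
    case False
    define r where "r = ell2_norm X \<xi>"
    have r: "r > 0" using False by (simp add: r_def less_le)
    define \<zeta> where "\<zeta> = (\<lambda>x. complex_of_real (1 / r) * \<xi> x)"
    have \<zeta>: "\<zeta> \<in> ell2 X" unfolding \<zeta>_def by (rule ell2_scale[OF \<xi>])
    have "ell2_norm X \<zeta> \<le> 1"
      using ell2_norm_scale_le[OF \<xi>, of "complex_of_real (1 / r)"] r
      by (simp add: \<zeta>_def norm_divide flip: r_def)
    then have le: "ell2_norm X (T \<zeta>) \<le> op_norm X T" using unit \<zeta> by simp
    have "\<xi> = (\<lambda>x. complex_of_real r * \<zeta> x)" using r by (simp add: \<zeta>_def)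
    then have "T \<xi> = (\<lambda>x. complex_of_real r * T \<zeta> x)"
      using bounded_ops_scale[OF assms \<zeta>] by metis
    then have "ell2_norm X (T \<xi>) \<le> r * ell2_norm X (T \<zeta>)"
      using ell2_norm_scale_le[OF bounded_ops_ell2[OF assms \<zeta>], of "complex_of_real r"] r by simp
    also have "\<dots> \<le> r * op_norm X T" using le r by simp
    finally show ?thesis by (simp add: r_def mult.commute)
  qed
qed

lemma
  assumes "S \<in> bounded_ops X" "T \<in> bounded_ops X"
  shows op_add_bounded: "op_add S T \<in> bounded_ops X"
    and op_norm_add_le: "op_norm X (op_add S T) \<le> op_norm X S + op_norm X T"
proof -
  have *: "ell2_norm X (op_add S T \<xi>) \<le> (op_norm X S + op_norm X T) * ell2_norm X \<xi>"
    if "\<xi> \<in> ell2 X" for \<xi>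
    using ell2_norm_triangle[OF bounded_ops_ell2[OF assms(1) that] bounded_ops_ell2[OF assms(2) that]]
      op_norm_bound[OF assms(1) that] op_norm_bound[OF assms(2) that]
    by (simp add: op_add_def distrib_right)
  show "op_add S T \<in> bounded_ops X"
    by (rule bounded_opsI[OF _ _ _ _ *])
      (use assms in \<open>auto simp: op_add_def bounded_ops_ell2 bounded_ops_outside bounded_ops_add
        bounded_ops_scale algebra_simps intro!: ell2_add\<close>)
  show "op_norm X (op_add S T) \<le> op_norm X S + op_norm X T"
    by (rule op_norm_le[OF *]) (use assms in \<open>auto simp: op_norm_nonneg\<close>)
qed

lemma
  assumes "T \<in> bounded_ops X"
  shows op_scale_bounded: "op_scale c T \<in> bounded_ops X"
    and op_norm_scale_le: "op_norm X (op_scale c T) \<le> cmod c * op_norm X T"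
proof -
  have *: "ell2_norm X (op_scale c T \<xi>) \<le> (cmod c * op_norm X T) * ell2_norm X \<xi>"
    if "\<xi> \<in> ell2 X" for \<xi>
    using ell2_norm_scale_le[OF bounded_ops_ell2[OF assms that], of c]
      mult_left_mono[OF op_norm_bound[OF assms that] norm_ge_zero[of c]]
    by (simp add: op_scale_def mult.assoc)
  show "op_scale c T \<in> bounded_ops X"
    by (rule bounded_opsI[OF _ _ _ _ *])
      (use assms in \<open>auto simp: op_scale_def bounded_ops_ell2 bounded_ops_outside bounded_ops_add
        bounded_ops_scale algebra_simps intro!: ell2_scale\<close>)
  show "op_norm X (op_scale c T) \<le> cmod c * op_norm X T"
    by (rule op_norm_le[OF *]) (use assms in \<open>auto simp: op_norm_nonneg\<close>)
qed

lemma
  assumes "S \<in> bounded_ops X" "T \<in> bounded_ops X"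
  shows op_comp_bounded: "S \<circ> T \<in> bounded_ops X"
    and op_norm_comp_le: "op_norm X (S \<circ> T) \<le> op_norm X S * op_norm X T"
proof -
  have *: "ell2_norm X ((S \<circ> T) \<xi>) \<le> (op_norm X S * op_norm X T) * ell2_norm X \<xi>"
    if "\<xi> \<in> ell2 X" for \<xi>
    using op_norm_bound[OF assms(1) bounded_ops_ell2[OF assms(2) that]]
      mult_left_mono[OF op_norm_bound[OF assms(2) that] op_norm_nonneg[OF assms(1)]]
    by (simp add: mult.assoc)
  show "S \<circ> T \<in> bounded_ops X"
    by (rule bounded_opsI[OF _ _ _ _ *])
      (use assms in \<open>auto simp: bounded_ops_ell2 bounded_ops_outside bounded_ops_add
        bounded_ops_scale bounded_ops_zero\<close>)
  show "op_norm X (S \<circ> T) \<le> op_norm X S * op_norm X T"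
    by (rule op_norm_le[OF *]) (use assms in \<open>auto simp: op_norm_nonneg\<close>)
qed

lemma op_diff_conv: "op_diff S T = op_add S (op_scale (-1) T)"
  by (simp add: op_diff_def op_add_def op_scale_def)

lemma op_diff_bounded: "S \<in> bounded_ops X \<Longrightarrow> T \<in> bounded_ops X \<Longrightarrow> op_diff S T \<in> bounded_ops X"
  by (simp add: op_diff_conv op_add_bounded op_scale_bounded)

lemma op_comp_diff_right:
  assumes "S \<in> bounded_ops X" "T \<in> bounded_ops X" "T' \<in> bounded_ops X"
  shows "op_diff (S \<circ> T) (S \<circ> T') = S \<circ> op_diff T T'"
proof
  fix \<xi>
  show "op_diff (S \<circ> T) (S \<circ> T') \<xi> = (S \<circ> op_diff T T') \<xi>"
    using bounded_ops_diff[OF assms(1), of "T \<xi>" "T' \<xi>"] assms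
    by (cases "\<xi> \<in> ell2 X")
      (auto simp: op_diff_def bounded_ops_ell2 bounded_ops_outside bounded_ops_zero)
qed

lemma op_comp_diff_left: "op_diff (S \<circ> T) (S' \<circ> T) = op_diff S S' \<circ> T"
  by (simp add: op_diff_def fun_eq_iff)

lemma is_adjoint_add:
  assumes "is_adjoint X T S" "is_adjoint X T' S'"
  shows "is_adjoint X (op_add T T') (op_add S S')"
  using assms unfolding is_adjoint_def
  by (simp add: op_add_bounded) (simp add: op_add_def ell2_inner_add_left ell2_inner_add_right
      bounded_ops_ell2)

lemma is_adjoint_scale:
  assumes "is_adjoint X T S"
  shows "is_adjoint X (op_scale c T) (op_scale (cnj c) S)"
  using assms unfolding is_adjoint_def
  by (simp add: op_scale_bounded) (simp add: op_scale_def ell2_inner_scale_left ell2_inner_scale_right)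

lemma is_adjoint_diff:
  assumes "is_adjoint X T S" "is_adjoint X T' S'"
  shows "is_adjoint X (op_diff T T') (op_diff S S')"
  using is_adjoint_add[OF assms(1) is_adjoint_scale[OF assms(2), of "-1"]]
  by (simp add: op_diff_conv)

lemma op_norm_adjoint_le:
  assumes "is_adjoint X T S"
  shows "op_norm X S \<le> op_norm X T"
proof (rule op_norm_le)
  have bdd: "T \<in> bounded_ops X" "S \<in> bounded_ops X" using assms by (auto simp: is_adjoint_def)
  show "0 \<le> op_norm X T" by (rule op_norm_nonneg[OF bdd(1)])
  fix \<eta> assume \<eta>: "\<eta> \<in> ell2 X"
  let ?n = "ell2_norm X (S \<eta>)"
  have S\<eta>: "S \<eta> \<in> ell2 X" using bdd \<eta> by (simp add: bounded_ops_ell2)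
  have "?n\<^sup>2 = cmod (ell2_inner X (S \<eta>) (S \<eta>))"
    unfolding ell2_inner_self[OF S\<eta>] norm_of_real by simp
  also have "\<dots> = cmod (ell2_inner X (T (S \<eta>)) \<eta>)"
    using assms \<eta> S\<eta> by (simp add: is_adjoint_def)
  also have "\<dots> \<le> ell2_norm X (T (S \<eta>)) * ell2_norm X \<eta>"
    by (rule ell2_Cauchy_Schwarz) (use \<eta> S\<eta> bdd in \<open>auto simp: bounded_ops_ell2\<close>)
  also have "\<dots> \<le> op_norm X T * ?n * ell2_norm X \<eta>"
    by (rule mult_right_mono[OF op_norm_bound[OF bdd(1) S\<eta>]]) simp
  finally have "?n * ?n \<le> (op_norm X T * ell2_norm X \<eta>) * ?n"
    by (simp add: power2_eq_square mult_ac)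
  then show "?n \<le> op_norm X T * ell2_norm X \<eta>"
    using ell2_norm_nonneg[of X "S \<eta>"] op_norm_nonneg[OF bdd(1)] ell2_norm_nonneg[of X \<eta>]
    by (metis mult_le_cancel_right mult_nonneg_nonneg order.order_iff_strict linorder_not_less)
qed

lemma bounded_ops_truncate_inner:
  assumes T: "T \<in> bounded_ops X" and \<eta>: "\<eta> \<in> ell2 X" and "finite F" "F \<subseteq> X"
  shows "ell2_inner X (T (truncate F \<xi>)) \<eta> = (\<Sum>x\<in>F. \<xi> x * ell2_inner X (T (point_mass x)) \<eta>)"
  using assms(3,4)
proof (induction F)
  case empty
  have "truncate {} \<xi> = (\<lambda>x. 0)" by (simp add: truncate_def)
  then show ?case by (simp add: bounded_ops_zero[OF T] ell2_inner_def)
next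
  case (insert x F)
  have pm: "point_mass x \<in> ell2 X" and tr: "truncate F \<xi> \<in> ell2 X"
    using insert.hyps insert.prems by (auto intro: point_mass_ell2 truncate_ell2)
  have "T (truncate (insert x F) \<xi>) = (\<lambda>y. \<xi> x * T (point_mass x) y + T (truncate F \<xi>) y)"
    by (simp add: truncate_insert[OF insert.hyps(2)] bounded_ops_add[OF T ell2_scale[OF pm] tr]
        bounded_ops_scale[OF T pm])
  then show ?case
    using insert ell2_inner_add_left[OF ell2_scale[OF bounded_ops_ell2[OF T pm]]
        bounded_ops_ell2[OF T tr] \<eta>]
    by (simp add: ell2_inner_scale_left)
qed

text \<open>
  The adjoint is written down on the orthonormal basis.  Testing \<open>T\<close> on the truncations of the
  candidate vector bounds its finite partial norms, and the adjoint identity, clear for finitely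
  supported vectors, extends by density.
\<close>

lemma bounded_op_has_adjoint:
  assumes T: "T \<in> bounded_ops X"
  shows "\<exists>S. is_adjoint X T S"
proof -
  define S where "S = (\<lambda>\<eta> x. if \<eta> \<in> ell2 X \<and> x \<in> X then ell2_inner X \<eta> (T (point_mass x)) else 0)"
  define K where "K = op_norm X T"
  have K: "0 \<le> K" unfolding K_def by (rule op_norm_nonneg[OF T])
  have S: "ell2_inner X (T (point_mass x)) \<eta> = cnj (S \<eta> x)" if "\<eta> \<in> ell2 X" "x \<in> X" for \<eta> x
    using that by (simp add: S_def flip: ell2_inner_commute)
  have fin: "L2_set (\<lambda>x. cmod (S \<eta> x)) F \<le> K * ell2_norm X \<eta>"
    if \<eta>: "\<eta> \<in> ell2 X" and F: "finite F" "F \<subseteq> X" for \<eta> F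
  proof -
    let ?L = "L2_set (\<lambda>x. cmod (S \<eta> x)) F"
    have tr: "truncate F (S \<eta>) \<in> ell2 X" by (rule truncate_ell2[OF F])
    have "of_real (?L\<^sup>2) = (\<Sum>x\<in>F. S \<eta> x * cnj (S \<eta> x))"
      by (simp add: L2_set_def sum_nonneg complex_norm_square del: of_real_power)
    also have "\<dots> = ell2_inner X (T (truncate F (S \<eta>))) \<eta>"
      unfolding bounded_ops_truncate_inner[OF T \<eta> F] using \<eta> F by (intro sum.cong) (auto simp: S)
    finally have "?L\<^sup>2 = cmod (ell2_inner X (T (truncate F (S \<eta>))) \<eta>)"
      by (metis norm_of_real abs_of_nonneg zero_le_power2)
    also have "\<dots> \<le> ell2_norm X (T (truncate F (S \<eta>))) * ell2_norm X \<eta>"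
      by (rule ell2_Cauchy_Schwarz[OF bounded_ops_ell2[OF T tr] \<eta>])
    also have "\<dots> \<le> (K * ell2_norm X (truncate F (S \<eta>))) * ell2_norm X \<eta>"
      unfolding K_def by (rule mult_right_mono[OF op_norm_bound[OF T tr]]) simp
    also have "\<dots> \<le> (K * ?L) * ell2_norm X \<eta>"
      using K by (intro mult_right_mono mult_left_mono ell2_norm_truncate_le[OF F]) auto
    finally have "?L * ?L \<le> (K * ell2_norm X \<eta>) * ?L" by (simp add: power2_eq_square mult_ac)
    then show ?thesis
      using L2_set_nonneg[of "\<lambda>x. cmod (S \<eta> x)" F] K ell2_norm_nonneg[of X \<eta>]
      by (metis mult_le_cancel_right mult_nonneg_nonneg order.order_iff_strict linorder_not_less)
  qed
  have S_ell2: "S \<eta> \<in> ell2 X" and S_norm: "ell2_norm X (S \<eta>) \<le> K * ell2_norm X \<eta>"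
    if "\<eta> \<in> ell2 X" for \<eta>
    by (rule ell2_norm_leI[OF _ fin[OF that]]; simp add: S_def)+
  have S_bdd: "S \<in> bounded_ops X"
  proof (rule bounded_opsI[where K = K])
    fix \<xi> \<eta> assume "\<xi> \<in> ell2 X" "\<eta> \<in> ell2 X"
    then show "S (\<lambda>x. \<xi> x + \<eta> x) = (\<lambda>x. S \<xi> x + S \<eta> x)"
      by (auto simp: S_def ell2_add ell2_inner_add_left bounded_ops_ell2[OF T] point_mass_ell2)
  next
    fix c \<xi> assume "\<xi> \<in> ell2 X"
    then show "S (\<lambda>x. c * \<xi> x) = (\<lambda>x. c * S \<xi> x)"
      by (auto simp: S_def ell2_scale ell2_inner_scale_left)
  qed (use S_ell2 S_norm in \<open>auto simp: S_def\<close>)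
  have "ell2_inner X (T \<xi>) \<eta> = ell2_inner X \<xi> (S \<eta>)" if \<xi>: "\<xi> \<in> ell2 X" and \<eta>: "\<eta> \<in> ell2 X" for \<xi> \<eta>
  proof -
    let ?D = "ell2_inner X (T \<xi>) \<eta> - ell2_inner X \<xi> (S \<eta>)"
    define C where "C = 2 * (K * ell2_norm X \<eta>)"
    have C: "0 \<le> C" using K by (simp add: C_def)
    have small: "cmod ?D \<le> C * \<epsilon>" if "\<epsilon> > 0" for \<epsilon>
    proof -
      obtain F where F: "finite F" "F \<subseteq> X"
        and le: "ell2_norm X (\<lambda>x. \<xi> x - truncate F \<xi> x) \<le> \<epsilon>"
        using truncate_approx[OF \<xi> \<open>\<epsilon> > 0\<close>] by auto
      define \<rho> where "\<rho> = (\<lambda>x. \<xi> x - truncate F \<xi> x)"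
      have tr: "truncate F \<xi> \<in> ell2 X" by (rule truncate_ell2[OF F])
      have \<rho>: "\<rho> \<in> ell2 X" unfolding \<rho>_def by (rule ell2_diff[OF \<xi> tr])
      have \<rho>_le: "ell2_norm X \<rho> \<le> \<epsilon>" using le by (simp add: \<rho>_def)
      have "ell2_inner X (truncate F \<xi>) (S \<eta>) = (\<Sum>\<^sub>\<infinity>x\<in>F. \<xi> x * cnj (S \<eta> x))"
        unfolding ell2_inner_def
        by (rule infsum_cong_neutral) (use F in \<open>auto simp: truncate_def\<close>)
      also have "\<dots> = ell2_inner X (T (truncate F \<xi>)) \<eta>"
        using F \<eta> by (auto simp: bounded_ops_truncate_inner[OF T \<eta> F] S intro!: sum.cong)
      finally have "?D = ell2_inner X (T \<rho>) \<eta> - ell2_inner X \<rho> (S \<eta>)"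
        unfolding \<rho>_def bounded_ops_diff[OF T \<xi> tr]
        by (simp add: ell2_inner_diff_left \<xi> \<eta> tr S_ell2 bounded_ops_ell2[OF T])
      also have "cmod \<dots> \<le> cmod (ell2_inner X (T \<rho>) \<eta>) + cmod (ell2_inner X \<rho> (S \<eta>))"
        by (rule norm_triangle_ineq4)
      also have "\<dots> \<le> ell2_norm X (T \<rho>) * ell2_norm X \<eta> + ell2_norm X \<rho> * ell2_norm X (S \<eta>)"
        by (intro add_mono ell2_Cauchy_Schwarz bounded_ops_ell2[OF T] \<rho> \<eta> S_ell2)
      also have "\<dots> \<le> (K * ell2_norm X \<rho>) * ell2_norm X \<eta> + ell2_norm X \<rho> * (K * ell2_norm X \<eta>)"
        unfolding K_def
        by (intro add_mono mult_right_mono mult_left_mono op_norm_bound[OF T \<rho>] S_norm[OF \<eta>, unfolded K_def]) auto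
      also have "\<dots> = C * ell2_norm X \<rho>" by (simp add: C_def)
      also have "\<dots> \<le> C * \<epsilon>" by (rule mult_left_mono[OF \<rho>_le C])
      finally show ?thesis .
    qed
    have "cmod ?D \<le> 0"
    proof (rule field_le_epsilon)
      fix e :: real assume "e > 0"
      have "cmod ?D \<le> C * (e / (C + 1))" using C \<open>e > 0\<close> by (intro small) auto
      also have "\<dots> \<le> e" using C \<open>e > 0\<close> by (simp add: field_simps)
      finally show "cmod ?D \<le> 0 + e" by simp
    qed
    then show ?thesis by simp
  qed
  then show ?thesis using T S_bdd unfolding is_adjoint_def by blast
qed

section \<open>The C*-algebra generated by a set closed under products and adjoints\<close>

inductive_set op_span :: "'a operator set \<Rightarrow> 'a operator set" for B where
  gen: "T \<in> B \<Longrightarrow> T \<in> op_span B"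
| add: "S \<in> op_span B \<Longrightarrow> T \<in> op_span B \<Longrightarrow> op_add S T \<in> op_span B"
| scale: "T \<in> op_span B \<Longrightarrow> op_scale c T \<in> op_span B"

definition op_closure :: "'a set \<Rightarrow> 'a operator set \<Rightarrow> 'a operator set" where
  "op_closure X D = {T \<in> bounded_ops X. \<forall>\<epsilon>>0. \<exists>S\<in>D. op_norm X (op_diff T S) < \<epsilon>}"

lemma op_closure_bounded: "op_closure X D \<subseteq> bounded_ops X"
  by (auto simp: op_closure_def)

lemma op_closure_approx:
  assumes "T \<in> op_closure X D" "0 < \<epsilon>"
  obtains S where "S \<in> D" "op_norm X (op_diff T S) < \<epsilon>"
  using assms by (auto simp: op_closure_def)

lemma op_norm_diff_self: "T \<in> bounded_ops X \<Longrightarrow> op_norm X (op_diff T T) = 0"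
  using op_norm_le[of X "op_diff T T" 0] op_norm_nonneg[OF op_diff_bounded[of T X T]]
  by (simp add: op_diff_def)

lemma subset_op_closure: "D \<subseteq> bounded_ops X \<Longrightarrow> D \<subseteq> op_closure X D"
  unfolding op_closure_def by (auto intro!: bexI simp: op_norm_diff_self subsetD)

lemma op_norm_diff_triangle:
  assumes "R \<in> bounded_ops X" "S \<in> bounded_ops X" "T \<in> bounded_ops X"
  shows "op_norm X (op_diff R T) \<le> op_norm X (op_diff R S) + op_norm X (op_diff S T)"
proof -
  have "op_diff R T = op_add (op_diff R S) (op_diff S T)"
    by (simp add: op_diff_def op_add_def)
  then show ?thesis using assms by (metis op_norm_add_le op_diff_bounded)
qed

lemma op_closure_closed:
  assumes D: "D \<subseteq> bounded_ops X" and T: "T \<in> bounded_ops X"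
    and approx: "\<And>\<epsilon>. \<epsilon> > 0 \<Longrightarrow> \<exists>S\<in>op_closure X D. op_norm X (op_diff T S) < \<epsilon>"
  shows "T \<in> op_closure X D"
proof -
  have "\<exists>S\<in>D. op_norm X (op_diff T S) < \<epsilon>" if "\<epsilon> > 0" for \<epsilon>
  proof -
    obtain R where R: "R \<in> op_closure X D" "op_norm X (op_diff T R) < \<epsilon> / 2"
      using approx[OF half_gt_zero[OF \<open>0 < \<epsilon>\<close>]] by blast
    obtain S where S: "S \<in> D" "op_norm X (op_diff R S) < \<epsilon> / 2"
      by (rule op_closure_approx[OF R(1) half_gt_zero[OF \<open>0 < \<epsilon>\<close>]])
    have "op_norm X (op_diff T S) < \<epsilon>"
      using op_norm_diff_triangle[of T X R S] T R S D by (auto simp: op_closure_def)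
    then show ?thesis using S by blast
  qed
  then show ?thesis using T by (simp add: op_closure_def)
qed

text \<open>
  Products are approximated one factor at a time: the norm of the other factor is then fixed, and
  the closure being closed makes the two steps combine.
\<close>

lemma op_closure_comp_right:
  assumes D: "D \<subseteq> bounded_ops X" and S: "S \<in> bounded_ops X"
    and mem: "\<And>T. T \<in> D \<Longrightarrow> S \<circ> T \<in> op_closure X D" and T: "T \<in> op_closure X D"
  shows "S \<circ> T \<in> op_closure X D"
proof (rule op_closure_closed[OF D])
  have Tb: "T \<in> bounded_ops X" using T op_closure_bounded by blast
  show "S \<circ> T \<in> bounded_ops X" by (rule op_comp_bounded[OF S Tb])
  fix \<epsilon> :: real assume "\<epsilon> > 0"
  have n: "0 \<le> op_norm X S" by (rule op_norm_nonneg[OF S])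
  obtain T' where T': "T' \<in> D" "op_norm X (op_diff T T') < \<epsilon> / (op_norm X S + 1)"
    by (rule op_closure_approx[OF T, of "\<epsilon> / (op_norm X S + 1)"]) (use \<open>\<epsilon> > 0\<close> n in auto)
  have T'b: "T' \<in> bounded_ops X" using T' D by blast
  have "op_norm X (op_diff (S \<circ> T) (S \<circ> T')) \<le> op_norm X S * op_norm X (op_diff T T')"
    unfolding op_comp_diff_right[OF S Tb T'b]
    by (rule op_norm_comp_le[OF S op_diff_bounded[OF Tb T'b]])
  also have "\<dots> \<le> op_norm X S * (\<epsilon> / (op_norm X S + 1))"
    using T' n by (intro mult_left_mono) auto
  also have "\<dots> < \<epsilon>" using n \<open>\<epsilon> > 0\<close> by (simp add: field_simps)
  finally show "\<exists>R\<in>op_closure X D. op_norm X (op_diff (S \<circ> T) R) < \<epsilon>"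
    using mem[OF T'(1)] by blast
qed

lemma op_closure_comp_left:
  assumes D: "D \<subseteq> bounded_ops X" and T: "T \<in> bounded_ops X"
    and mem: "\<And>S. S \<in> D \<Longrightarrow> S \<circ> T \<in> op_closure X D" and S: "S \<in> op_closure X D"
  shows "S \<circ> T \<in> op_closure X D"
proof (rule op_closure_closed[OF D])
  have Sb: "S \<in> bounded_ops X" using S op_closure_bounded by blast
  show "S \<circ> T \<in> bounded_ops X" by (rule op_comp_bounded[OF Sb T])
  fix \<epsilon> :: real assume "\<epsilon> > 0"
  have n: "0 \<le> op_norm X T" by (rule op_norm_nonneg[OF T])
  obtain S' where S': "S' \<in> D" "op_norm X (op_diff S S') < \<epsilon> / (op_norm X T + 1)"
    by (rule op_closure_approx[OF S, of "\<epsilon> / (op_norm X T + 1)"]) (use \<open>\<epsilon> > 0\<close> n in auto)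
  have S'b: "S' \<in> bounded_ops X" using S' D by blast
  have "op_norm X (op_diff (S \<circ> T) (S' \<circ> T)) \<le> op_norm X (op_diff S S') * op_norm X T"
    unfolding op_comp_diff_left by (rule op_norm_comp_le[OF op_diff_bounded[OF Sb S'b] T])
  also have "\<dots> \<le> (\<epsilon> / (op_norm X T + 1)) * op_norm X T"
    using S' n by (intro mult_right_mono) auto
  also have "\<dots> < \<epsilon>" using n \<open>\<epsilon> > 0\<close> by (simp add: field_simps)
  finally show "\<exists>R\<in>op_closure X D. op_norm X (op_diff (S \<circ> T) R) < \<epsilon>"
    using mem[OF S'(1)] by blast
qed

lemma op_closure_add:
  assumes D: "D \<subseteq> bounded_ops X" and add: "\<And>S T. S \<in> D \<Longrightarrow> T \<in> D \<Longrightarrow> op_add S T \<in> D"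
    and S: "S \<in> op_closure X D" and T: "T \<in> op_closure X D"
  shows "op_add S T \<in> op_closure X D"
proof -
  have b: "S \<in> bounded_ops X" "T \<in> bounded_ops X" using S T op_closure_bounded by blast+
  have "\<exists>R\<in>D. op_norm X (op_diff (op_add S T) R) < \<epsilon>" if "\<epsilon> > 0" for \<epsilon>
  proof -
    obtain S' where S': "S' \<in> D" "op_norm X (op_diff S S') < \<epsilon> / 2"
      by (rule op_closure_approx[OF S half_gt_zero[OF \<open>\<epsilon> > 0\<close>]])
    obtain T' where T': "T' \<in> D" "op_norm X (op_diff T T') < \<epsilon> / 2"
      by (rule op_closure_approx[OF T half_gt_zero[OF \<open>\<epsilon> > 0\<close>]])
    have "op_diff (op_add S T) (op_add S' T') = op_add (op_diff S S') (op_diff T T')"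
      by (simp add: op_diff_def op_add_def fun_eq_iff)
    moreover have "op_diff S S' \<in> bounded_ops X" "op_diff T T' \<in> bounded_ops X"
      using b S' T' D by (auto intro!: op_diff_bounded)
    ultimately have "op_norm X (op_diff (op_add S T) (op_add S' T')) < \<epsilon>"
      using op_norm_add_le[of "op_diff S S'" X "op_diff T T'"] S' T' by simp
    then show ?thesis using add S' T' by blast
  qed
  then show ?thesis using b by (simp add: op_closure_def op_add_bounded)
qed

lemma op_closure_scale:
  assumes D: "D \<subseteq> bounded_ops X" and scale: "\<And>T. T \<in> D \<Longrightarrow> op_scale c T \<in> D"
    and T: "T \<in> op_closure X D"
  shows "op_scale c T \<in> op_closure X D"
proof -
  have b: "T \<in> bounded_ops X" using T op_closure_bounded by blast
  have "\<exists>R\<in>D. op_norm X (op_diff (op_scale c T) R) < \<epsilon>" if "\<epsilon> > 0" for \<epsilon>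
  proof -
    have "\<epsilon> / (cmod c + 1) > 0" using that by (simp add: add_nonneg_pos)
    then obtain T' where T': "T' \<in> D" "op_norm X (op_diff T T') < \<epsilon> / (cmod c + 1)"
      using op_closure_approx[OF T] by blast
    have "op_diff (op_scale c T) (op_scale c T') = op_scale c (op_diff T T')"
      by (simp add: op_diff_def op_scale_def fun_eq_iff algebra_simps)
    then have "op_norm X (op_diff (op_scale c T) (op_scale c T')) \<le> cmod c * op_norm X (op_diff T T')"
      using op_norm_scale_le[OF op_diff_bounded[OF b], of T' c] T' D by auto
    also have "\<dots> \<le> cmod c * (\<epsilon> / (cmod c + 1))"
      using T' by (intro mult_left_mono) auto
    also have "\<dots> < \<epsilon>" using that by (simp add: field_simps add_pos_nonneg)
    finally show ?thesis using scale T' by blast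
  qed
  then show ?thesis using b by (simp add: op_closure_def op_scale_bounded)
qed

lemma op_closure_adjoint:
  assumes D: "D \<subseteq> bounded_ops X" and adj: "\<And>T. T \<in> D \<Longrightarrow> \<exists>S\<in>D. is_adjoint X T S"
    and T: "T \<in> op_closure X D"
  shows "\<exists>S\<in>op_closure X D. is_adjoint X T S"
proof -
  have b: "T \<in> bounded_ops X" using T op_closure_bounded by blast
  obtain S where S: "is_adjoint X T S" using bounded_op_has_adjoint[OF b] by blast
  have "\<exists>R\<in>D. op_norm X (op_diff S R) < \<epsilon>" if "\<epsilon> > 0" for \<epsilon>
  proof -
    obtain T' where T': "T' \<in> D" "op_norm X (op_diff T T') < \<epsilon>"
      by (rule op_closure_approx[OF T \<open>\<epsilon> > 0\<close>])
    obtain R where R: "R \<in> D" "is_adjoint X T' R" using adj[OF T'(1)] by blast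
    have "op_norm X (op_diff S R) \<le> op_norm X (op_diff T T')"
      by (rule op_norm_adjoint_le[OF is_adjoint_diff[OF S R(2)]])
    then show ?thesis using R T' by force
  qed
  then have "S \<in> op_closure X D" using S by (simp add: op_closure_def is_adjoint_def)
  then show ?thesis using S by blast
qed

lemma op_span_bounded:
  assumes "B \<subseteq> bounded_ops X" shows "op_span B \<subseteq> bounded_ops X"
proof
  fix T assume "T \<in> op_span B"
  then show "T \<in> bounded_ops X"
    by induction (use assms in \<open>auto intro: op_add_bounded op_scale_bounded\<close>)
qed

lemma op_span_comp:
  assumes B: "B \<subseteq> bounded_ops X" and mult: "\<And>S T. S \<in> B \<Longrightarrow> T \<in> B \<Longrightarrow> S \<circ> T \<in> op_span B"
    and "S \<in> op_span B" "T \<in> op_span B"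
  shows "S \<circ> T \<in> op_span B"
  using assms(3)
proof induction
  case (gen S)
  have Sb: "S \<in> bounded_ops X" using gen B by blast
  from assms(4) show ?case
  proof induction
    case (gen T)
    then show ?case using mult \<open>S \<in> B\<close> by blast
  next
    case (add R T)
    have Rb: "R \<in> bounded_ops X" "T \<in> bounded_ops X" using add op_span_bounded[OF B] by blast+
    have "S (\<lambda>x. R \<xi> x + T \<xi> x) = (\<lambda>x. S (R \<xi>) x + S (T \<xi>) x)" for \<xi>
      using bounded_ops_add[OF Sb, of "R \<xi>" "T \<xi>"] Rb bounded_ops_zero[OF Sb]
      by (cases "\<xi> \<in> ell2 X") (auto simp: bounded_ops_ell2 bounded_ops_outside)
    then have "S \<circ> op_add R T = op_add (S \<circ> R) (S \<circ> T)"
      by (simp add: op_add_def fun_eq_iff)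
    then show ?case using op_span.add[OF add.IH] by (simp add: o_def)
  next
    case (scale T c)
    have Tb: "T \<in> bounded_ops X" using scale op_span_bounded[OF B] by blast
    have "S (\<lambda>x. c * T \<xi> x) = (\<lambda>x. c * S (T \<xi>) x)" for \<xi>
      using bounded_ops_scale[OF Sb, of "T \<xi>" c] Tb bounded_ops_zero[OF Sb]
      by (cases "\<xi> \<in> ell2 X") (auto simp: bounded_ops_ell2 bounded_ops_outside)
    then have "S \<circ> op_scale c T = op_scale c (S \<circ> T)"
      by (simp add: op_scale_def fun_eq_iff)
    then show ?case using op_span.scale[OF scale.IH, of c] by (simp add: o_def)
  qed
next
  case (add R S)
  have "op_add R S \<circ> T = op_add (R \<circ> T) (S \<circ> T)" by (simp add: op_add_def fun_eq_iff)
  then show ?case using op_span.add[OF add.IH] by (simp add: o_def)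
next
  case (scale S c)
  have "op_scale c S \<circ> T = op_scale c (S \<circ> T)" by (simp add: op_scale_def fun_eq_iff)
  then show ?case using op_span.scale[OF scale.IH, of c] by (simp add: o_def)
qed

lemma op_span_adjoint:
  assumes "\<And>T. T \<in> B \<Longrightarrow> \<exists>S\<in>op_span B. is_adjoint X T S" and "T \<in> op_span B"
  shows "\<exists>S\<in>op_span B. is_adjoint X T S"
  using assms(2)
proof induction
  case (gen T)
  then show ?case by (rule assms(1))
next
  case (add S T)
  then show ?case by (meson op_span.add is_adjoint_add)
next
  case (scale T c)
  then show ?case by (meson op_span.scale is_adjoint_scale)
qed

text \<open>
  Under these hypotheses the linear span is already a *-algebra, so its norm closure is the
  generated C*-algebra: density of the span is the tool for comparing functionals on it.
\<close>

lemma
  assumes B: "B \<subseteq> bounded_ops X" "B \<noteq> {}"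
    and mult: "\<And>S T. S \<in> B \<Longrightarrow> T \<in> B \<Longrightarrow> S \<circ> T \<in> op_span B"
    and adj: "\<And>T. T \<in> B \<Longrightarrow> \<exists>S\<in>op_span B. is_adjoint X T S"
  shows op_closure_span_cstar: "concrete_cstar_algebra X (op_closure X (op_span B))"
    and cstar_generated_eq_closure_span: "cstar_generated X B = op_closure X (op_span B)"
proof -
  let ?D = "op_span B" and ?E = "op_closure X (op_span B)"
  have D: "?D \<subseteq> bounded_ops X" by (rule op_span_bounded[OF B(1)])
  have DE: "?D \<subseteq> ?E" by (rule subset_op_closure[OF D])
  obtain T0 where "T0 \<in> B" using B(2) by blast
  then have "op_scale 0 T0 \<in> ?D" by (intro op_span.intros)
  then have zero: "op_zero \<in> ?E" using DE by (auto simp: op_scale_def op_zero_def)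
  have comp: "S \<circ> T \<in> ?E" if S: "S \<in> ?E" and T: "T \<in> ?E" for S T
  proof (rule op_closure_comp_left[OF D _ _ S])
    show "T \<in> bounded_ops X" using T op_closure_bounded by blast
    fix S' assume S': "S' \<in> ?D"
    show "S' \<circ> T \<in> ?E"
      by (rule op_closure_comp_right[OF D _ _ T])
        (use S' D DE op_span_comp[OF B(1) mult S'] in auto)
  qed
  show cstar: "concrete_cstar_algebra X ?E"
    unfolding concrete_cstar_algebra_def
  proof (intro conjI ballI allI impI)
    show "\<exists>S\<in>?E. is_adjoint X T S" if "T \<in> ?E" for T
    proof (rule op_closure_adjoint[OF D _ that])
      show "\<exists>S\<in>?D. is_adjoint X T S" if "T \<in> ?D" for T
        by (rule op_span_adjoint[OF _ that]) (rule adj)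
    qed
    show "T \<in> ?E" if "T \<in> bounded_ops X" "\<forall>\<epsilon>>0. \<exists>S\<in>?E. op_norm X (op_diff T S) < \<epsilon>" for T
      by (rule op_closure_closed[OF D that(1)]) (use that(2) in blast)
  qed (use op_closure_bounded zero comp op_closure_add[OF D op_span.add]
    op_closure_scale[OF D op_span.scale] in auto)
  have "?E \<subseteq> A" if A: "concrete_cstar_algebra X A" "B \<subseteq> A" for A
  proof -
    have "T \<in> A" if "T \<in> ?D" for T
      using that by induction (use A in \<open>auto simp: concrete_cstar_algebra_def\<close>)
    then show ?thesis
      using A(1) unfolding concrete_cstar_algebra_def op_closure_def by blast
  qed
  moreover have "B \<subseteq> ?E" using DE op_span.gen by blast
  ultimately show "cstar_generated X B = ?E"
    unfolding cstar_generated_def using cstar by blast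
qed

definition bounded_functional :: "'a set \<Rightarrow> 'a operator set \<Rightarrow> ('a operator \<Rightarrow> complex) \<Rightarrow> bool" where
  "bounded_functional X A f \<longleftrightarrow>
     (\<forall>S\<in>A. \<forall>T\<in>A. f (op_add S T) = f S + f T) \<and>
     (\<forall>c. \<forall>T\<in>A. f (op_scale c T) = c * f T) \<and>
     (\<exists>K\<ge>0. \<forall>T\<in>A. cmod (f T) \<le> K * op_norm X T)"

lemma bounded_functional_eqI:
  assumes B: "B \<subseteq> bounded_ops X"
    and f: "bounded_functional X (op_closure X (op_span B)) f"
    and g: "bounded_functional X (op_closure X (op_span B)) g"
    and eq: "\<And>T. T \<in> B \<Longrightarrow> f T = g T"
    and T: "T \<in> op_closure X (op_span B)"
  shows "f T = g T"
proof -
  let ?D = "op_span B" and ?E = "op_closure X (op_span B)"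
  have D: "?D \<subseteq> bounded_ops X" by (rule op_span_bounded[OF B])
  have DE: "?D \<subseteq> ?E" by (rule subset_op_closure[OF D])
  have span: "f S = g S" if "S \<in> ?D" for S
    using that
  proof induction
    case (add S T)
    then have "S \<in> ?E" "T \<in> ?E" using DE by blast+
    then show ?case using add f g unfolding bounded_functional_def by metis
  next
    case (scale T c)
    then have "T \<in> ?E" using DE by blast
    then show ?case using scale f g unfolding bounded_functional_def by metis
  qed (rule eq)
  obtain K L where K: "0 \<le> K" "\<And>T. T \<in> ?E \<Longrightarrow> cmod (f T) \<le> K * op_norm X T"
    and L: "0 \<le> L" "\<And>T. T \<in> ?E \<Longrightarrow> cmod (g T) \<le> L * op_norm X T"
    using f g unfolding bounded_functional_def by metis
  have diff: "h (op_diff T S) = h T - h S" "op_diff T S \<in> ?E"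
    if "bounded_functional X ?E h" "S \<in> ?D" for h S
  proof -
    have s: "op_scale (-1) S \<in> ?E" using that(2) DE op_span.scale by blast
    show "op_diff T S \<in> ?E"
      unfolding op_diff_conv by (rule op_closure_add[OF D op_span.add T s])
    have "h (op_diff T S) = h T + h (op_scale (-1) S)"
      using that(1) T s unfolding op_diff_conv bounded_functional_def by blast
    also have "h (op_scale (-1) S) = -1 * h S"
      using that DE unfolding bounded_functional_def by blast
    finally show "h (op_diff T S) = h T - h S" by simp
  qed
  have "cmod (f T - g T) \<le> 0"
  proof (rule field_le_epsilon)
    fix e :: real assume "e > 0"
    then have "e / (K + L + 1) > 0" using K L by simp
    then obtain S where S: "S \<in> ?D" "op_norm X (op_diff T S) < e / (K + L + 1)"
      using op_closure_approx[OF T] by blast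
    have "f T - g T = f (op_diff T S) - g (op_diff T S)"
      by (simp add: diff(1)[OF f S(1)] diff(1)[OF g S(1)] span[OF S(1)])
    then have "cmod (f T - g T) \<le> cmod (f (op_diff T S)) + cmod (g (op_diff T S))"
      by (metis norm_triangle_ineq4)
    also have "\<dots> \<le> (K + L) * op_norm X (op_diff T S)"
      using K(2) L(2) diff(2)[OF f S(1)] by (simp add: distrib_right add_mono)
    also have "\<dots> \<le> (K + L) * (e / (K + L + 1))"
      using S(2) K(1) L(1) by (intro mult_left_mono) auto
    also have "\<dots> \<le> e" using K L \<open>e > 0\<close> by (simp add: field_simps)
    finally show "cmod (f T - g T) \<le> 0 + e" by simp
  qed
  then show ?thesis by simp
qed

section \<open>Ping-pong configurations\<close>

text \<open>
  A configuration on a subgroup \<open>H\<close> spreads to the whole group because \<open>G\<close> is a union of right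
  cosets of \<open>H\<close>: with a representative \<open>r z\<close> of the coset of \<open>z\<close>, the set \<open>T j\<close> is pulled back
  along \<open>z \<mapsto> z \<otimes> inv (r z)\<close>.  Left multiplication by \<open>y j = x j \<otimes> g \<otimes> inv (x j)\<close> preserves the
  cosets since \<open>y j\<close> lies in \<open>H\<close>: for \<open>n \<ge> 2\<close> the set \<open>H - T j\<close> is nonempty, and \<open>y j\<close> moves it
  into \<open>H\<close>.
\<close>

lemma (in group) BP_on_carrier:
  assumes "property_BP G" and g: "g \<in> carrier G" "g \<noteq> \<one>" and n: "n \<ge> 2"
  shows "\<exists>x S. disjoint_family_on S {1..n::nat} \<and>
    (\<forall>j\<in>{1..n}. x j \<in> carrier G \<and> S j \<noteq> {} \<and> S j \<subseteq> carrier G \<and>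
      (\<forall>z\<in>carrier G - S j. (x j \<otimes> g \<otimes> inv (x j)) \<otimes> z \<in> S j))"
proof -
  obtain x H T where x: "x ` {1..n} \<subseteq> carrier G" and H: "subgroup H G"
    and disj: "disjoint_family_on T {1..n}"
    and T: "\<And>j. j \<in> {1..n} \<Longrightarrow> T j \<noteq> {}" "\<And>j. j \<in> {1..n} \<Longrightarrow> T j \<subseteq> H"
      "\<And>j. j \<in> {1..n} \<Longrightarrow> (x j \<otimes> g \<otimes> inv (x j)) <# (H - T j) \<subseteq> T j"
    using assms unfolding property_BP_def by (metis (no_types, lifting) DiffI singletonD)
  define y where "y = (\<lambda>j. x j \<otimes> g \<otimes> inv (x j))"
  define r where "r = (\<lambda>z. SOME w. w \<in> H #> z)"
  define S where "S = (\<lambda>j. {z \<in> carrier G. z \<otimes> inv (r z) \<in> T j})"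
  have HG: "h \<in> carrier G" if "h \<in> H" for h using that subgroup.mem_carrier[OF H] by blast
  have y: "y j \<in> carrier G" if "j \<in> {1..n}" for j
    using image_subset_iff[THEN iffD1, OF x] g that by (simp add: y_def)
  have ping: "y j \<otimes> h \<in> T j" if "j \<in> {1..n}" "h \<in> H - T j" for j h
    using T(3)[OF that(1)] that(2) by (auto simp: y_def l_coset_def)
  have r: "r z \<in> H #> z" if "z \<in> carrier G" for z
    unfolding r_def by (rule someI, rule rcos_self[OF that H])
  have rG: "r z \<in> carrier G" if "z \<in> carrier G" for z
    using r[OF that] that HG by (auto simp: r_coset_def)
  have r_mult: "r (h \<otimes> z) = r z" if "h \<in> H" "z \<in> carrier G" for h z
  proof -
    have "h \<otimes> z \<in> H #> z" using that by (auto simp: r_coset_def)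
    then have "H #> z = H #> (h \<otimes> z)" by (rule repr_independence[OF _ that(2) H])
    then show ?thesis by (simp add: r_def)
  qed
  have quot: "z \<otimes> inv (r z) \<in> H" if z: "z \<in> carrier G" for z
  proof -
    obtain h where h: "h \<in> H" "r z = h \<otimes> z" using r[OF z] by (auto simp: r_coset_def)
    have "z \<otimes> inv (r z) = inv h"
      using h z HG by (simp add: inv_mult_group flip: m_assoc)
    then show ?thesis using h subgroup.m_inv_closed[OF H] by simp
  qed
  have yH: "y j \<in> H" if j: "j \<in> {1..n}" for j
  proof -
    obtain k where k: "k \<in> {1..n}" "k \<noteq> j"
      using n by (metis atLeastAtMost_iff le_numeral_extra(4) numeral_le_one_iff one_le_numeral
          order_trans semiring_norm(69) numeral_One)
    obtain h where h: "h \<in> T k" using T(1)[OF k(1)] by blast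
    have hH: "h \<in> H - T j"
      using h T(2)[OF k(1)] disjoint_family_onD[OF disj k(1) j k(2)] by blast
    then have "y j \<otimes> h \<in> H" using ping[OF j] T(2)[OF j] by blast
    then have "y j \<otimes> h \<otimes> inv h \<in> H"
      using hH subgroup.m_closed[OF H] subgroup.m_inv_closed[OF H] by blast
    then show ?thesis using hH HG y[OF j] by (simp add: m_assoc)
  qed
  show ?thesis
  proof (intro exI[of _ x] exI[of _ S] conjI ballI)
    show "x j \<in> carrier G" if "j \<in> {1..n}" for j using x that by blast
    show "disjoint_family_on S {1..n}"
      using disj by (auto simp: S_def disjoint_family_on_def)
    show "S j \<subseteq> carrier G" for j by (auto simp: S_def)
    fix j assume j: "j \<in> {1..n}"
    obtain t where t: "t \<in> T j" "t \<in> H" using T(1,2)[OF j] by blast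
    obtain h where h: "h \<in> H" "r \<one> = h \<otimes> \<one>" using r[of \<one>] by (auto simp: r_coset_def)
    have "r (r \<one>) = r \<one>" using r_mult[OF h(1), of \<one>] h(2) by simp
    then have "r (t \<otimes> r \<one>) = r \<one>" using r_mult[OF t(2) rG[of \<one>]] by simp
    then have "t \<otimes> r \<one> \<in> S j"
      using t HG rG[of \<one>] by (simp add: S_def m_assoc)
    then show "S j \<noteq> {}" by blast
    fix z assume z: "z \<in> carrier G - S j"
    have "z \<otimes> inv (r z) \<in> H - T j" using z quot by (auto simp: S_def)
    then have "y j \<otimes> (z \<otimes> inv (r z)) \<in> T j" by (rule ping[OF j])
    moreover have "r (y j \<otimes> z) = r z" using r_mult[OF yH[OF j]] z by blast
    ultimately have "y j \<otimes> z \<in> S j"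
      using z y[OF j] rG[of z] by (simp add: S_def m_assoc)
    then show "x j \<otimes> g \<otimes> inv (x j) \<otimes> z \<in> S j" by (simp add: y_def)
  qed
qed

text \<open>
  For \<open>n \<ge> 3\<close> the \<open>n\<close> conjugates of \<open>g\<close> in a ping-pong configuration are distinct, so that the
  conjugacy class has at least \<open>n\<close> elements.
\<close>

lemma (in group) property_BP_imp_ICC:
  assumes BP: "property_BP G"
  shows "ICC G"
  unfolding ICC_def
proof (intro ballI notI)
  fix g assume g: "g \<in> carrier G - {\<one>}" and fin: "finite (conjugacy_class G g)"
  define n where "n = card (conjugacy_class G g) + 3"
  have n: "n \<ge> 2" by (simp add: n_def)
  obtain x S where disj: "disjoint_family_on S {1..n}"
    and xS: "\<forall>j\<in>{1..n}. x j \<in> carrier G \<and> S j \<noteq> {} \<and> S j \<subseteq> carrier G \<and>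
      (\<forall>z\<in>carrier G - S j. (x j \<otimes> g \<otimes> inv (x j)) \<otimes> z \<in> S j)"
    using BP_on_carrier[OF BP _ _ n, of g] g by blast
  have x: "\<And>j. j \<in> {1..n} \<Longrightarrow> x j \<in> carrier G"
    and ne: "\<And>j. j \<in> {1..n} \<Longrightarrow> S j \<noteq> {}" and sub: "\<And>j. j \<in> {1..n} \<Longrightarrow> S j \<subseteq> carrier G"
    and ping: "\<And>j z. j \<in> {1..n} \<Longrightarrow> z \<in> carrier G - S j \<Longrightarrow> x j \<otimes> g \<otimes> inv (x j) \<otimes> z \<in> S j"
    using xS by blast+
  have "inj_on (\<lambda>j. x j \<otimes> g \<otimes> inv (x j)) {1..n}"
  proof (rule inj_onI, rule ccontr)
    fix j k assume j: "j \<in> {1..n}" and k: "k \<in> {1..n}"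
      and eq: "x j \<otimes> g \<otimes> inv (x j) = x k \<otimes> g \<otimes> inv (x k)" and "j \<noteq> k"
    \<comment> \<open>a third set supplies a point moved into both \<open>S j\<close> and \<open>S k\<close>\<close>
    have "\<exists>l\<in>{1,2,3::nat}. l \<noteq> j \<and> l \<noteq> k" by auto
    then obtain l where l: "l \<in> {1..n}" "l \<noteq> j" "l \<noteq> k" by (fastforce simp: n_def)
    obtain z where z: "z \<in> S l" using ne[OF l(1)] by blast
    have "z \<in> carrier G - S j" "z \<in> carrier G - S k"
      using z sub[OF l(1)] disjoint_family_onD[OF disj l(1) j l(2)]
        disjoint_family_onD[OF disj l(1) k l(3)] by blast+
    then have "x j \<otimes> g \<otimes> inv (x j) \<otimes> z \<in> S j \<inter> S k"
      using ping[OF j] ping[OF k] eq by auto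
    then show False using disjoint_family_onD[OF disj j k \<open>j \<noteq> k\<close>] by blast
  qed
  moreover have "(\<lambda>j. x j \<otimes> g \<otimes> inv (x j)) ` {1..n} \<subseteq> conjugacy_class G g"
    using x by (auto simp: conjugacy_class_def)
  ultimately have "card {1..n} \<le> card (conjugacy_class G g)"
    using fin by (rule card_inj_on_le)
  then show False by (simp add: n_def)
qed

lemma (in group) sum_left_translate:
  assumes "y \<in> carrier G" "F \<subseteq> carrier G"
  shows "(\<Sum>x\<in>F. f (inv y \<otimes> x)) = sum f ((\<lambda>x. inv y \<otimes> x) ` F)"
proof -
  have "inj_on (\<lambda>x. inv y \<otimes> x) F"
    using inj_on_cmult[OF inv_closed[OF assms(1)]] assms(2) by (rule inj_on_subset)
  then show ?thesis by (simp add: sum.reindex)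
qed

lemma square_add_le: "(a + b)\<^sup>2 \<le> 2 * a\<^sup>2 + 2 * b\<^sup>2" for a b :: real
  using sum_squares_bound[of a b] by (simp add: power2_sum)

text \<open>
  At a point \<open>x\<close> at most one index satisfies \<open>x \<in> S j\<close>, and for all others \<open>inv (y j) \<otimes> x\<close> lies
  in \<open>S j\<close>.  The Cauchy-Schwarz inequality bounds the two parts by the sum of all squares and by
  \<open>card J\<close> times the squares of \<open>f\<close> on the \<open>S j\<close>; as these sets are disjoint, the second
  contributes only \<open>card J\<close> times the square norm of \<open>f\<close> in total, like the first.
\<close>

lemma (in group) ping_pong_sum_bound:
  fixes f :: "'a \<Rightarrow> real"
  assumes J: "finite J" and y: "\<And>j. j \<in> J \<Longrightarrow> y j \<in> carrier G"
    and disj: "disjoint_family_on S J"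
    and ping: "\<And>j z. j \<in> J \<Longrightarrow> z \<in> carrier G - S j \<Longrightarrow> y j \<otimes> z \<in> S j"
    and M: "\<And>F. finite F \<Longrightarrow> F \<subseteq> carrier G \<Longrightarrow> (\<Sum>x\<in>F. (f x)\<^sup>2) \<le> M"
    and F: "finite F" "F \<subseteq> carrier G"
  shows "(\<Sum>x\<in>F. (\<Sum>j\<in>J. f (inv (y j) \<otimes> x))\<^sup>2) \<le> 4 * real (card J) * M"
proof -
  define u where "u = (\<lambda>j x. inv (y j) \<otimes> x)"
  define q where "q = (\<lambda>j z. if z \<in> S j then (f z)\<^sup>2 else 0)"
  have u: "u j x \<in> carrier G" if "j \<in> J" "x \<in> carrier G" for j x
    using that y by (simp add: u_def)
  have point: "(\<Sum>j\<in>J. f (u j x))\<^sup>2 \<le> 2 * (\<Sum>j\<in>J. (f (u j x))\<^sup>2) + 2 * real (card J) * (\<Sum>j\<in>J. q j (u j x))"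
    if x: "x \<in> carrier G" for x
  proof -
    define A where "A = {j \<in> J. x \<in> S j}"
    have A: "A \<subseteq> J" "finite A" using J by (auto simp: A_def)
    have "card A \<le> 1"
      using disj A(2) by (auto simp: card_le_Suc0_iff_eq A_def disjoint_family_on_def)
    then have "real (card A) \<le> 1" by simp
    have pulled: "u j x \<in> S j" if "j \<in> J - A" for j
    proof (rule ccontr)
      assume "u j x \<notin> S j"
      then have "y j \<otimes> u j x \<in> S j" using ping that u x by blast
      moreover have "y j \<otimes> u j x = x" using that x y by (simp add: u_def flip: m_assoc)
      ultimately show False using that by (simp add: A_def)
    qed
    have "(\<Sum>j\<in>A. f (u j x))\<^sup>2 \<le> (\<Sum>j\<in>A. (f (u j x))\<^sup>2) * real (card A)"
      using sum_squared_le_sum_of_squares[of "\<lambda>j. f (u j x)" A] A by simp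
    also have "\<dots> \<le> (\<Sum>j\<in>A. (f (u j x))\<^sup>2)"
      using \<open>real (card A) \<le> 1\<close> by (simp add: mult_left_le sum_nonneg)
    also have "\<dots> \<le> (\<Sum>j\<in>J. (f (u j x))\<^sup>2)" using J A by (intro sum_mono2) auto
    finally have 1: "(\<Sum>j\<in>A. f (u j x))\<^sup>2 \<le> (\<Sum>j\<in>J. (f (u j x))\<^sup>2)" .
    have "(\<Sum>j\<in>J-A. f (u j x))\<^sup>2 \<le> (\<Sum>j\<in>J-A. (f (u j x))\<^sup>2) * real (card (J - A))"
      using sum_squared_le_sum_of_squares[of "\<lambda>j. f (u j x)" "J - A"] J by simp
    also have "(\<Sum>j\<in>J-A. (f (u j x))\<^sup>2) = (\<Sum>j\<in>J-A. q j (u j x))"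
      using pulled by (intro sum.cong) (auto simp: q_def)
    also have "\<dots> * real (card (J - A)) \<le> (\<Sum>j\<in>J. q j (u j x)) * real (card J)"
      using J by (intro mult_mono sum_mono2) (auto simp: q_def card_mono intro!: sum_nonneg)
    finally have 2: "(\<Sum>j\<in>J-A. f (u j x))\<^sup>2 \<le> real (card J) * (\<Sum>j\<in>J. q j (u j x))"
      by (simp add: mult.commute)
    have "(\<Sum>j\<in>J. f (u j x)) = (\<Sum>j\<in>J-A. f (u j x)) + (\<Sum>j\<in>A. f (u j x))"
      by (rule sum.subset_diff[OF A(1) J])
    then have "(\<Sum>j\<in>J. f (u j x))\<^sup>2 = ((\<Sum>j\<in>J-A. f (u j x)) + (\<Sum>j\<in>A. f (u j x)))\<^sup>2"
      by simp
    also have "\<dots> \<le> 2 * (\<Sum>j\<in>J-A. f (u j x))\<^sup>2 + 2 * (\<Sum>j\<in>A. f (u j x))\<^sup>2"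
      by (rule square_add_le)
    also have "\<dots> \<le> 2 * (real (card J) * (\<Sum>j\<in>J. q j (u j x))) + 2 * (\<Sum>j\<in>J. (f (u j x))\<^sup>2)"
      by (intro add_mono mult_left_mono 1 2) auto
    finally show ?thesis by (simp add: mult.assoc)
  qed
  have "(\<Sum>x\<in>F. (\<Sum>j\<in>J. f (u j x))\<^sup>2)
      \<le> (\<Sum>x\<in>F. 2 * (\<Sum>j\<in>J. (f (u j x))\<^sup>2) + 2 * real (card J) * (\<Sum>j\<in>J. q j (u j x)))"
    using F by (intro sum_mono point) auto
  also have "\<dots> = 2 * (\<Sum>j\<in>J. \<Sum>x\<in>F. (f (u j x))\<^sup>2) + 2 * real (card J) * (\<Sum>j\<in>J. \<Sum>x\<in>F. q j (u j x))"
    by (simp add: sum.distrib sum.swap[of _ F J] flip: sum_distrib_left)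
  also have "\<dots> \<le> 2 * (real (card J) * M) + 2 * real (card J) * M"
  proof (intro add_mono mult_left_mono)
    have "(\<Sum>j\<in>J. \<Sum>x\<in>F. (f (u j x))\<^sup>2) \<le> (\<Sum>j\<in>J. M)"
    proof (rule sum_mono)
      fix j assume j: "j \<in> J"
      have "(\<Sum>x\<in>F. (f (u j x))\<^sup>2) = (\<Sum>z\<in>u j ` F. (f z)\<^sup>2)"
        using sum_left_translate[OF y[OF j] F(2), of "\<lambda>z. (f z)\<^sup>2"] by (simp add: u_def)
      also have "\<dots> \<le> M" using F u j by (intro M) auto
      finally show "(\<Sum>x\<in>F. (f (u j x))\<^sup>2) \<le> M" .
    qed
    then show "(\<Sum>j\<in>J. \<Sum>x\<in>F. (f (u j x))\<^sup>2) \<le> real (card J) * M" by simp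
    have "(\<Sum>x\<in>F. q j (u j x)) = (\<Sum>z\<in>u j ` F \<inter> S j. (f z)\<^sup>2)" if j: "j \<in> J" for j
    proof -
      have "(\<Sum>x\<in>F. q j (u j x)) = (\<Sum>z\<in>u j ` F. q j z)"
        using sum_left_translate[OF y[OF j] F(2), of "q j"] by (simp add: u_def)
      also have "\<dots> = (\<Sum>z\<in>u j ` F \<inter> S j. (f z)\<^sup>2)"
        by (rule sum.mono_neutral_cong_right) (use F in \<open>auto simp: q_def\<close>)
      finally show ?thesis .
    qed
    then have "(\<Sum>j\<in>J. \<Sum>x\<in>F. q j (u j x)) = (\<Sum>j\<in>J. \<Sum>z\<in>u j ` F \<inter> S j. (f z)\<^sup>2)"
      by (rule sum.cong[OF refl])
    also have "\<dots> = (\<Sum>z\<in>(\<Union>j\<in>J. u j ` F \<inter> S j). (f z)\<^sup>2)"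
      by (rule sum.UNION_disjoint[symmetric]) (use J F disj in \<open>auto simp: disjoint_family_on_def\<close>)
    also have "\<dots> \<le> M" using J F u by (intro M) auto
    finally show "(\<Sum>j\<in>J. \<Sum>x\<in>F. q j (u j x)) \<le> M" .
  qed auto
  finally show ?thesis by (simp add: u_def mult_ac)
qed

section \<open>The twisted regular representation\<close>

locale twisted_group = group G for G :: "('a, 'b) monoid_scheme" (structure) +
  fixes \<sigma> :: "'a \<Rightarrow> 'a \<Rightarrow> complex"
  assumes cocycle: "\<sigma> \<in> cocycles2 G"
begin

abbreviation lam :: "'a \<Rightarrow> 'a operator" where
  "lam \<equiv> twisted_regular G \<sigma>"

lemma cmod_sigma: "g \<in> carrier G \<Longrightarrow> h \<in> carrier G \<Longrightarrow> cmod (\<sigma> g h) = 1"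
  and sigma_one: "g \<in> carrier G \<Longrightarrow> \<sigma> g \<one> = 1" "g \<in> carrier G \<Longrightarrow> \<sigma> \<one> g = 1"
  and sigma_assoc: "g \<in> carrier G \<Longrightarrow> h \<in> carrier G \<Longrightarrow> k \<in> carrier G \<Longrightarrow>
    \<sigma> g h * \<sigma> (g \<otimes> h) k = \<sigma> h k * \<sigma> g (h \<otimes> k)"
  using cocycle by (auto simp: cocycles2_def)

lemma sigma_inverse_commute: "g \<in> carrier G \<Longrightarrow> \<sigma> g (inv g) = \<sigma> (inv g) g"
  using sigma_assoc[of g "inv g" g] by (simp add: sigma_one)

lemma lam_apply: "\<xi> \<in> ell2 (carrier G) \<Longrightarrow> x \<in> carrier G \<Longrightarrow>
    lam g \<xi> x = \<sigma> g (inv g \<otimes> x) * \<xi> (inv g \<otimes> x)"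
  and lam_outside: "x \<notin> carrier G \<Longrightarrow> lam g \<xi> x = 0"
  and lam_not_ell2: "\<xi> \<notin> ell2 (carrier G) \<Longrightarrow> lam g \<xi> = (\<lambda>x. 0)"
  by (auto simp: twisted_regular_def)

lemma cmod_lam: "\<xi> \<in> ell2 (carrier G) \<Longrightarrow> x \<in> carrier G \<Longrightarrow> g \<in> carrier G \<Longrightarrow>
    cmod (lam g \<xi> x) = cmod (\<xi> (inv g \<otimes> x))"
  by (simp add: lam_apply norm_mult cmod_sigma)

lemma
  assumes g: "g \<in> carrier G"
  shows lam_bounded: "lam g \<in> bounded_ops (carrier G)"
    and op_norm_lam_le: "op_norm (carrier G) (lam g) \<le> 1"
proof -
  have fin: "L2_set (\<lambda>x. cmod (lam g \<xi> x)) F \<le> ell2_norm (carrier G) \<xi>"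
    if \<xi>: "\<xi> \<in> ell2 (carrier G)" and F: "finite F" "F \<subseteq> carrier G" for \<xi> F
  proof -
    have "(\<Sum>x\<in>F. (cmod (lam g \<xi> x))\<^sup>2) = (\<Sum>x\<in>F. (cmod (\<xi> (inv g \<otimes> x)))\<^sup>2)"
      using F \<xi> g by (intro sum.cong) (auto simp: cmod_lam)
    also have "\<dots> = (\<Sum>z\<in>(\<lambda>x. inv g \<otimes> x) ` F. (cmod (\<xi> z))\<^sup>2)"
      by (rule sum_left_translate[OF g F(2)])
    finally show ?thesis
      using L2_set_le_ell2_norm[OF \<xi>, of "(\<lambda>x. inv g \<otimes> x) ` F"] F g
      by (auto simp: L2_set_def)
  qed
  have mem: "lam g \<xi> \<in> ell2 (carrier G)"
    and norm: "ell2_norm (carrier G) (lam g \<xi>) \<le> 1 * ell2_norm (carrier G) \<xi>"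
    if "\<xi> \<in> ell2 (carrier G)" for \<xi>
    using ell2_norm_leI[OF lam_outside fin[OF that]] by auto
  show "lam g \<in> bounded_ops (carrier G)"
    by (rule bounded_opsI[OF mem lam_not_ell2 _ _ norm])
      (auto simp: twisted_regular_def ell2_add ell2_scale algebra_simps)
  show "op_norm (carrier G) (lam g) \<le> 1" by (rule op_norm_le[OF norm]) auto
qed

lemma lam_comp:
  assumes g: "g \<in> carrier G" and h: "h \<in> carrier G"
  shows "lam g \<circ> lam h = op_scale (\<sigma> g h) (lam (g \<otimes> h))"
proof (intro ext)
  fix \<xi> x
  show "(lam g \<circ> lam h) \<xi> x = op_scale (\<sigma> g h) (lam (g \<otimes> h)) \<xi> x"
  proof (cases "\<xi> \<in> ell2 (carrier G) \<and> x \<in> carrier G")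
    case True
    define k where "k = inv (g \<otimes> h) \<otimes> x"
    have k: "k \<in> carrier G" using True g h by (simp add: k_def)
    have hk: "h \<otimes> k = inv g \<otimes> x" "inv h \<otimes> (inv g \<otimes> x) = k"
      using True g h by (simp_all add: k_def inv_mult_group m_assoc flip: m_assoc[of h])
    have "(lam g \<circ> lam h) \<xi> x = \<sigma> g (h \<otimes> k) * (\<sigma> h k * \<xi> k)"
      using True g h by (simp add: lam_apply bounded_ops_ell2[OF lam_bounded] hk)
    also have "\<dots> = (\<sigma> g h * \<sigma> (g \<otimes> h) k) * \<xi> k"
      using sigma_assoc[OF g h k] by (simp add: mult_ac)
    finally show ?thesis using True by (simp add: op_scale_def lam_apply k_def mult.assoc)
  next
    case False
    then show ?thesis
      using bounded_ops_zero[OF lam_bounded[OF g]]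
      by (auto simp: op_scale_def lam_outside lam_not_ell2)
  qed
qed

lemma lam_adjoint:
  assumes g: "g \<in> carrier G"
  shows "is_adjoint (carrier G) (lam g) (op_scale (cnj (\<sigma> g (inv g))) (lam (inv g)))"
  unfolding is_adjoint_def
proof (intro conjI ballI)
  show "lam g \<in> bounded_ops (carrier G)" by (rule lam_bounded[OF g])
  show "op_scale (cnj (\<sigma> g (inv g))) (lam (inv g)) \<in> bounded_ops (carrier G)"
    using g by (intro op_scale_bounded lam_bounded) simp
  fix \<xi> \<eta> assume \<xi>: "\<xi> \<in> ell2 (carrier G)" and \<eta>: "\<eta> \<in> ell2 (carrier G)"
  have val: "cnj (op_scale (cnj (\<sigma> g (inv g))) (lam (inv g)) \<eta> z) = \<sigma> g z * cnj (\<eta> (g \<otimes> z))"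
    if z: "z \<in> carrier G" for z
  proof -
    have "\<sigma> g (inv g) = \<sigma> (inv g) (g \<otimes> z) * \<sigma> g z"
      using sigma_assoc[OF g inv_closed[OF g], of "g \<otimes> z"] g z
      by (simp add: sigma_one flip: m_assoc)
    then have "\<sigma> g (inv g) * cnj (\<sigma> (inv g) (g \<otimes> z))
        = (\<sigma> (inv g) (g \<otimes> z) * cnj (\<sigma> (inv g) (g \<otimes> z))) * \<sigma> g z"
      by (simp add: mult_ac)
    also have "\<sigma> (inv g) (g \<otimes> z) * cnj (\<sigma> (inv g) (g \<otimes> z)) = 1"
      using g z cmod_sigma[of "inv g" "g \<otimes> z"] by (simp flip: complex_norm_square)
    finally show ?thesis using \<eta> g z by (simp add: op_scale_def lam_apply)
  qed
  show "ell2_inner (carrier G) (lam g \<xi>) \<eta>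
      = ell2_inner (carrier G) \<xi> (op_scale (cnj (\<sigma> g (inv g))) (lam (inv g)) \<eta>)"
    unfolding ell2_inner_def
    by (rule infsum_reindex_bij_witness[where j = "\<lambda>x. inv g \<otimes> x" and i = "\<lambda>z. g \<otimes> z"])
      (use g \<xi> in \<open>auto simp: val lam_apply mult_ac simp flip: m_assoc\<close>)
qed

abbreviation alg :: "'a operator set" where
  "alg \<equiv> reduced_twisted_cstar G \<sigma>"

lemma
  shows lam_image_bounded: "lam ` carrier G \<subseteq> bounded_ops (carrier G)"
    and alg_eq: "alg = op_closure (carrier G) (op_span (lam ` carrier G))"
    and alg_cstar: "concrete_cstar_algebra (carrier G) alg"
proof -
  show B: "lam ` carrier G \<subseteq> bounded_ops (carrier G)" using lam_bounded by blast
  have ne: "lam ` carrier G \<noteq> {}" by blast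
  have mult: "S \<circ> T \<in> op_span (lam ` carrier G)"
    if ST: "S \<in> lam ` carrier G" "T \<in> lam ` carrier G" for S T
  proof -
    obtain g h where gh: "g \<in> carrier G" "h \<in> carrier G" "S = lam g" "T = lam h"
      using ST by blast
    have "op_scale (\<sigma> g h) (lam (g \<otimes> h)) \<in> op_span (lam ` carrier G)"
      using gh by (intro op_span.scale op_span.gen) auto
    then show ?thesis using gh by (simp add: lam_comp)
  qed
  have adj: "\<exists>S\<in>op_span (lam ` carrier G). is_adjoint (carrier G) T S"
    if T: "T \<in> lam ` carrier G" for T
  proof -
    obtain g where g: "g \<in> carrier G" "T = lam g" using T by blast
    have "op_scale (cnj (\<sigma> g (inv g))) (lam (inv g)) \<in> op_span (lam ` carrier G)"
      using g by (intro op_span.intros) auto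
    then show ?thesis using lam_adjoint[OF g(1)] g(2) by blast
  qed
  show "alg = op_closure (carrier G) (op_span (lam ` carrier G))"
    unfolding reduced_twisted_cstar_def
    by (rule cstar_generated_eq_closure_span[OF B ne mult adj])
  then show "concrete_cstar_algebra (carrier G) alg"
    using op_closure_span_cstar[OF B ne mult adj] by simp
qed

lemma alg_bounded: "T \<in> alg \<Longrightarrow> T \<in> bounded_ops (carrier G)"
  and alg_add: "S \<in> alg \<Longrightarrow> T \<in> alg \<Longrightarrow> op_add S T \<in> alg"
  and alg_scale: "T \<in> alg \<Longrightarrow> op_scale c T \<in> alg"
  and alg_comp: "S \<in> alg \<Longrightarrow> T \<in> alg \<Longrightarrow> S \<circ> T \<in> alg"
  and alg_zero: "op_zero \<in> alg"
  using alg_cstar by (auto simp: concrete_cstar_algebra_def)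

lemma lam_in_alg: "g \<in> carrier G \<Longrightarrow> lam g \<in> alg"
  unfolding alg_eq using subset_op_closure[OF op_span_bounded[OF lam_image_bounded]]
  by (auto intro: op_span.gen)

section \<open>The canonical trace\<close>

definition canonical_trace :: "'a operator \<Rightarrow> complex" where
  "canonical_trace = restrict (\<lambda>T. T (point_mass \<one>) \<one>) alg"

lemma canonical_trace_apply: "T \<in> alg \<Longrightarrow> canonical_trace T = T (point_mass \<one>) \<one>"
  by (simp add: canonical_trace_def)

lemma canonical_trace_lam: "g \<in> carrier G \<Longrightarrow> canonical_trace (lam g) = (if g = \<one> then 1 else 0)"
  by (auto simp: canonical_trace_apply lam_in_alg lam_apply point_mass_ell2 sigma_one)
    (auto simp: point_mass_def)

lemma canonical_trace_add: "S \<in> alg \<Longrightarrow> T \<in> alg \<Longrightarrow>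
    canonical_trace (op_add S T) = canonical_trace S + canonical_trace T"
  and canonical_trace_scale: "T \<in> alg \<Longrightarrow> canonical_trace (op_scale c T) = c * canonical_trace T"
  by (simp_all add: canonical_trace_apply alg_add alg_scale) (simp_all add: op_add_def op_scale_def)

lemma cmod_canonical_trace_le:
  assumes "T \<in> alg"
  shows "cmod (canonical_trace T) \<le> op_norm (carrier G) T"
proof -
  have T: "T \<in> bounded_ops (carrier G)" by (rule alg_bounded[OF assms])
  have pm: "point_mass \<one> \<in> ell2 (carrier G)" by (simp add: point_mass_ell2)
  have "cmod (canonical_trace T) \<le> ell2_norm (carrier G) (T (point_mass \<one>))"
    by (simp add: canonical_trace_apply assms cmod_le_ell2_norm bounded_ops_ell2[OF T pm])
  also have "\<dots> \<le> op_norm (carrier G) T * ell2_norm (carrier G) (point_mass \<one>)"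
    by (rule op_norm_bound[OF T pm])
  also have "\<dots> \<le> op_norm (carrier G) T"
    by (simp add: mult_left_le ell2_norm_point_mass_le op_norm_nonneg[OF T])
  finally show ?thesis .
qed

text \<open>
  On \<open>lam g\<close> and \<open>lam h\<close> both sides vanish unless \<open>h = inv g\<close>, where they agree by the symmetry
  \<open>\<sigma> g (inv g) = \<sigma> (inv g) g\<close>.  Both sides are linear and bounded in each variable, so the
  identity extends to the whole algebra one variable at a time.
\<close>

lemma canonical_trace_commute:
  assumes S: "S \<in> alg" and T: "T \<in> alg"
  shows "canonical_trace (S \<circ> T) = canonical_trace (T \<circ> S)"
proof -
  have left: "bounded_functional (carrier G) alg (\<lambda>S. canonical_trace (S \<circ> T))" (is ?L)
    and right: "bounded_functional (carrier G) alg (\<lambda>S. canonical_trace (T \<circ> S))" (is ?R)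
    if T: "T \<in> alg" for T
  proof -
    have Tb: "T \<in> bounded_ops (carrier G)" by (rule alg_bounded[OF T])
    have 1: "canonical_trace (op_add R S \<circ> T) = canonical_trace (R \<circ> T) + canonical_trace (S \<circ> T)"
      if "R \<in> alg" "S \<in> alg" for R S
    proof -
      have "op_add R S \<circ> T = op_add (R \<circ> T) (S \<circ> T)" by (simp add: op_add_def fun_eq_iff)
      then show ?thesis using that T by (simp add: canonical_trace_add alg_comp)
    qed
    have 2: "canonical_trace (op_scale c S \<circ> T) = c * canonical_trace (S \<circ> T)" if "S \<in> alg" for c S
    proof -
      have "op_scale c S \<circ> T = op_scale c (S \<circ> T)" by (simp add: op_scale_def fun_eq_iff)
      then show ?thesis using that T by (simp add: canonical_trace_scale alg_comp)
    qed
    have pm: "point_mass \<one> \<in> ell2 (carrier G)" by (simp add: point_mass_ell2)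
    have 3: "canonical_trace (T \<circ> op_add R S) = canonical_trace (T \<circ> R) + canonical_trace (T \<circ> S)"
      if "R \<in> alg" "S \<in> alg" for R S
      using bounded_ops_add[OF Tb, of "R (point_mass \<one>)" "S (point_mass \<one>)"] that T pm
      by (simp add: canonical_trace_apply alg_comp alg_add)
        (simp add: op_add_def alg_bounded bounded_ops_ell2)
    have 4: "canonical_trace (T \<circ> op_scale c S) = c * canonical_trace (T \<circ> S)" if "S \<in> alg" for c S
      using bounded_ops_scale[OF Tb, of "S (point_mass \<one>)" c] that T pm
      by (simp add: canonical_trace_apply alg_comp alg_scale)
        (simp add: op_scale_def alg_bounded bounded_ops_ell2)
    have 5: "cmod (canonical_trace (S \<circ> T)) \<le> op_norm (carrier G) T * op_norm (carrier G) S"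
      "cmod (canonical_trace (T \<circ> S)) \<le> op_norm (carrier G) T * op_norm (carrier G) S"
      if S: "S \<in> alg" for S
      using cmod_canonical_trace_le[OF alg_comp[OF S T]] cmod_canonical_trace_le[OF alg_comp[OF T S]]
        op_norm_comp_le[OF Tb alg_bounded[OF S]] op_norm_comp_le[OF alg_bounded[OF S] Tb]
      by (simp_all add: mult.commute)
    show ?L unfolding bounded_functional_def using 1 2 5 op_norm_nonneg[OF Tb] by blast
    show ?R unfolding bounded_functional_def using 3 4 5 op_norm_nonneg[OF Tb] by blast
  qed
  have gens: "canonical_trace (lam g \<circ> lam h) = canonical_trace (lam h \<circ> lam g)"
    if "g \<in> carrier G" "h \<in> carrier G" for g h
  proof -
    have "g \<otimes> h = \<one> \<longleftrightarrow> h = inv g" "h \<otimes> g = \<one> \<longleftrightarrow> h = inv g"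
      using that by (metis inv_equality inv_inv r_inv l_inv inv_closed)+
    then show ?thesis
      using that by (auto simp: lam_comp canonical_trace_scale lam_in_alg canonical_trace_lam
          sigma_inverse_commute)
  qed
  have "canonical_trace (S \<circ> lam h) = canonical_trace (lam h \<circ> S)" if h: "h \<in> carrier G" for h
    by (rule bounded_functional_eqI[OF lam_image_bounded left[OF lam_in_alg[OF h], unfolded alg_eq]
          right[OF lam_in_alg[OF h], unfolded alg_eq] _ S[unfolded alg_eq]])
      (use gens h in auto)
  then show ?thesis
    by (intro bounded_functional_eqI[OF lam_image_bounded right[OF S, unfolded alg_eq]
          left[OF S, unfolded alg_eq] _ T[unfolded alg_eq]]) auto
qed

lemma canonical_trace_tracial: "tracial_state (carrier G) alg canonical_trace"
  unfolding tracial_state_def cstar_state_def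
proof (intro conjI ballI allI impI)
  show "canonical_trace \<in> extensional alg" by (simp add: canonical_trace_def)
  show "canonical_trace (op_add S T) = canonical_trace S + canonical_trace T"
    if "S \<in> alg" "T \<in> alg" for S T
    using that by (rule canonical_trace_add)
  show "canonical_trace (op_scale c T) = c * canonical_trace T" if "T \<in> alg" for c T
    using that by (rule canonical_trace_scale)
  show "canonical_trace (S \<circ> T) = canonical_trace (T \<circ> S)" if "S \<in> alg" "T \<in> alg" for S T
    using that by (rule canonical_trace_commute)
  show "canonical_trace (S \<circ> T) \<in> \<real>\<^sub>\<ge>\<^sub>0"
    if T: "T \<in> alg" and S: "S \<in> alg" and adj: "is_adjoint (carrier G) T S" for S T
  proof -
    let ?v = "T (point_mass \<one>)"
    have pm: "point_mass \<one> \<in> ell2 (carrier G)" by (simp add: point_mass_ell2)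
    have v: "?v \<in> ell2 (carrier G)" by (rule bounded_ops_ell2[OF alg_bounded[OF T] pm])
    have "cnj (S ?v \<one>) = ell2_inner (carrier G) (point_mass \<one>) (S ?v)"
      by (simp add: ell2_inner_point_mass_left)
    also have "\<dots> = ell2_inner (carrier G) ?v ?v"
      using adj pm v by (simp add: is_adjoint_def)
    also have "\<dots> = of_real ((ell2_norm (carrier G) ?v)\<^sup>2)" by (rule ell2_inner_self[OF v])
    finally have "S ?v \<one> = of_real ((ell2_norm (carrier G) ?v)\<^sup>2)"
      by (metis complex_cnj_cnj complex_cnj_complex_of_real)
    then show ?thesis
      by (simp add: canonical_trace_apply alg_comp S T del: of_real_power)
  qed
  let ?B = "{T \<in> alg. op_norm (carrier G) T \<le> 1}"
  have le: "cmod (canonical_trace T) \<le> 1" if "T \<in> ?B" for T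
    using that cmod_canonical_trace_le[of T] by auto
  then show bdd: "bdd_above ((\<lambda>T. cmod (canonical_trace T)) ` ?B)" by (intro bdd_aboveI2)
  have one: "lam \<one> \<in> ?B" by (simp add: lam_in_alg op_norm_lam_le)
  show "(SUP T\<in>?B. cmod (canonical_trace T)) = 1"
  proof (rule antisym)
    show "(SUP T\<in>?B. cmod (canonical_trace T)) \<le> 1" by (rule cSUP_least[OF _ le]) (use one in blast)
    show "1 \<le> (SUP T\<in>?B. cmod (canonical_trace T))"
      using cSUP_upper[OF one bdd] by (simp add: canonical_trace_lam)
  qed
qed

section \<open>Uniqueness of the trace\<close>

lemma cstar_state_contractive:
  assumes \<phi>: "cstar_state (carrier G) alg \<phi>" and T: "T \<in> alg"
    and r: "op_norm (carrier G) T \<le> r" "0 < r"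
  shows "cmod (\<phi> T) \<le> r"
proof -
  let ?U = "op_scale (complex_of_real (1 / r)) T"
  have Tb: "T \<in> bounded_ops (carrier G)" by (rule alg_bounded[OF T])
  have "op_norm (carrier G) ?U \<le> 1 / r * op_norm (carrier G) T"
    using op_norm_scale_le[OF Tb, of "complex_of_real (1 / r)"] r by (simp add: norm_divide)
  also have "\<dots> \<le> 1" using r by simp
  finally have U: "?U \<in> {T \<in> alg. op_norm (carrier G) T \<le> 1}" using alg_scale[OF T] by blast
  have "cmod (\<phi> ?U) \<le> 1"
    using cSUP_upper[OF U, of "\<lambda>T. cmod (\<phi> T)"] \<phi> by (simp add: cstar_state_def)
  moreover have "\<phi> ?U = complex_of_real (1 / r) * \<phi> T"
    using \<phi> T unfolding cstar_state_def by blast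
  ultimately show ?thesis using r by (simp add: norm_mult norm_divide pos_divide_le_eq)
qed

lemma cstar_state_bounded_functional:
  assumes \<phi>: "cstar_state (carrier G) alg \<phi>"
  shows "bounded_functional (carrier G) alg \<phi>"
proof -
  have "cmod (\<phi> T) \<le> 1 * op_norm (carrier G) T" if T: "T \<in> alg" for T
  proof (rule field_le_epsilon)
    fix e :: real assume "e > 0"
    then show "cmod (\<phi> T) \<le> 1 * op_norm (carrier G) T + e"
      using op_norm_nonneg[OF alg_bounded[OF T]]
      by (intro cstar_state_contractive[OF \<phi> T]) auto
  qed
  then have "\<exists>K\<ge>0. \<forall>T\<in>alg. cmod (\<phi> T) \<le> K * op_norm (carrier G) T"
    by (intro exI[of _ 1]) simp
  moreover have "(\<forall>S\<in>alg. \<forall>T\<in>alg. \<phi> (op_add S T) = \<phi> S + \<phi> T) \<and>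
      (\<forall>c. \<forall>T\<in>alg. \<phi> (op_scale c T) = c * \<phi> T)"
    using \<phi> unfolding cstar_state_def by - (elim conjE, intro conjI)
  ultimately show ?thesis unfolding bounded_functional_def by - (elim conjE, intro conjI)
qed

text \<open>
  \<open>lam x \<circ> lam g \<circ> lam (inv x)\<close> and \<open>lam g \<circ> lam (inv x) \<circ> lam x\<close> are cyclic permutations of each
  other, hence have the same trace; composing them with the cocycle relation leaves unimodular
  multiples of \<open>lam (x \<otimes> g \<otimes> inv x)\<close> and of \<open>lam g\<close>.
\<close>

lemma trace_conjugate:
  assumes \<phi>: "tracial_state (carrier G) alg \<phi>" and g: "g \<in> carrier G" and x: "x \<in> carrier G"
  obtains c where "cmod c = 1" "\<phi> (lam g) = c * \<phi> (lam (x \<otimes> g \<otimes> inv x))"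
proof -
  have ix: "inv x \<in> carrier G" using x by simp
  have sc: "\<phi> (op_scale c T) = c * \<phi> T" if "T \<in> alg" for c T
    using \<phi> that by (simp add: tracial_state_def cstar_state_def)
  have comp_scale: "op_scale c S \<circ> T = op_scale c (S \<circ> T)" for c and S T :: "'a operator"
    by (simp add: op_scale_def fun_eq_iff)
  define a where "a = \<sigma> x g * \<sigma> (x \<otimes> g) (inv x)"
  define b where "b = \<sigma> g (inv x) * \<sigma> (g \<otimes> inv x) x"
  have ab: "cmod a = 1" "cmod b = 1"
    using g x by (simp_all add: a_def b_def norm_mult cmod_sigma)
  have "\<phi> ((lam x \<circ> lam g) \<circ> lam (inv x)) = a * \<phi> (lam (x \<otimes> g \<otimes> inv x))"
    using g x by (simp add: lam_comp comp_scale sc alg_scale lam_in_alg a_def)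
  moreover have "\<phi> ((lam g \<circ> lam (inv x)) \<circ> lam x) = b * \<phi> (lam g)"
    using g x by (simp add: lam_comp comp_scale sc alg_scale lam_in_alg b_def m_assoc)
  moreover have "\<phi> (lam x \<circ> (lam g \<circ> lam (inv x))) = \<phi> ((lam g \<circ> lam (inv x)) \<circ> lam x)"
    using \<phi> alg_comp[OF lam_in_alg[OF g] lam_in_alg[OF ix]] lam_in_alg[OF x]
    unfolding tracial_state_def by blast
  ultimately have "b * \<phi> (lam g) = a * \<phi> (lam (x \<otimes> g \<otimes> inv x))"
    by (simp only: comp_assoc)
  then have "\<phi> (lam g) = (a / b) * \<phi> (lam (x \<otimes> g \<otimes> inv x))"
    using ab(2) by (metis nonzero_mult_div_cancel_left norm_zero times_divide_eq_left zero_neq_one)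
  moreover have "cmod (a / b) = 1" using ab by (simp add: norm_divide)
  ultimately show thesis using that by blast
qed

lemma
  assumes "finite J" "\<And>j. j \<in> J \<Longrightarrow> T j \<in> alg"
  shows alg_sum: "(\<lambda>\<xi> x. \<Sum>j\<in>J. T j \<xi> x) \<in> alg"
    and cstar_state_sum: "cstar_state (carrier G) alg \<phi> \<Longrightarrow>
      \<phi> (\<lambda>\<xi> x. \<Sum>j\<in>J. T j \<xi> x) = (\<Sum>j\<in>J. \<phi> (T j))"
proof -
  have "(\<lambda>\<xi> x. \<Sum>j\<in>J. T j \<xi> x) \<in> alg \<and> (cstar_state (carrier G) alg \<phi> \<longrightarrow>
      \<phi> (\<lambda>\<xi> x. \<Sum>j\<in>J. T j \<xi> x) = (\<Sum>j\<in>J. \<phi> (T j)))"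
    using assms
  proof (induction J)
    case empty
    have "\<phi> op_zero = 0" if "cstar_state (carrier G) alg \<phi>"
    proof -
      have "\<phi> (op_scale 0 op_zero) = 0 * \<phi> op_zero"
        using that alg_zero unfolding cstar_state_def by blast
      then show ?thesis by (simp add: op_scale_def op_zero_def)
    qed
    then show ?case using alg_zero by (simp add: op_zero_def)
  next
    case (insert j J)
    have "(\<lambda>\<xi> x. \<Sum>i\<in>insert j J. T i \<xi> x) = op_add (T j) (\<lambda>\<xi> x. \<Sum>i\<in>J. T i \<xi> x)"
      using insert.hyps by (simp add: op_add_def)
    then show ?case
      using insert by (simp add: alg_add cstar_state_def)
  qed
  then show "(\<lambda>\<xi> x. \<Sum>j\<in>J. T j \<xi> x) \<in> alg"
    "cstar_state (carrier G) alg \<phi> \<Longrightarrow> \<phi> (\<lambda>\<xi> x. \<Sum>j\<in>J. T j \<xi> x) = (\<Sum>j\<in>J. \<phi> (T j))"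
    by auto
qed

text \<open>
  By conjugation invariance \<open>n * \<phi> (lam g)\<close> is the value of \<open>\<phi>\<close> at a sum of \<open>n\<close> unimodular
  multiples of conjugates of \<open>lam g\<close>.  For the conjugates given by property (BP) this sum has norm
  at most \<open>2 * sqrt n\<close>, so that \<open>\<phi> (lam g)\<close> is bounded by \<open>2 / sqrt n\<close> for every \<open>n\<close>.
\<close>

lemma trace_lam_bound:
  assumes BP: "property_BP G" and \<phi>: "tracial_state (carrier G) alg \<phi>"
    and g: "g \<in> carrier G" "g \<noteq> \<one>" and n: "n \<ge> 2"
  shows "real n * cmod (\<phi> (lam g)) \<le> 2 * sqrt (real n)"
proof -
  have st: "cstar_state (carrier G) alg \<phi>" using \<phi> by (simp add: tracial_state_def)
  let ?J = "{1..n}"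
  obtain x S where disj: "disjoint_family_on S ?J"
    and xS: "\<forall>j\<in>?J. x j \<in> carrier G \<and> S j \<noteq> {} \<and> S j \<subseteq> carrier G \<and>
      (\<forall>z\<in>carrier G - S j. (x j \<otimes> g \<otimes> inv (x j)) \<otimes> z \<in> S j)"
    using BP_on_carrier[OF BP g n] by blast
  have x: "\<And>j. j \<in> ?J \<Longrightarrow> x j \<in> carrier G"
    and ping: "\<And>j z. j \<in> ?J \<Longrightarrow> z \<in> carrier G - S j \<Longrightarrow> x j \<otimes> g \<otimes> inv (x j) \<otimes> z \<in> S j"
    using xS by blast+
  define y where "y = (\<lambda>j. x j \<otimes> g \<otimes> inv (x j))"
  have y: "y j \<in> carrier G" if "j \<in> ?J" for j using x[OF that] g by (simp add: y_def)
  have "\<exists>c. cmod c = 1 \<and> \<phi> (lam g) = c * \<phi> (lam (y j))" if "j \<in> ?J" for j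
    using trace_conjugate[OF \<phi> g(1) x[OF that]] unfolding y_def by metis
  then obtain c where c: "\<And>j. j \<in> ?J \<Longrightarrow> cmod (c j) = 1"
    "\<And>j. j \<in> ?J \<Longrightarrow> \<phi> (lam g) = c j * \<phi> (lam (y j))"
    by metis
  define U where "U = (\<lambda>\<xi> z. \<Sum>j\<in>?J. op_scale (c j) (lam (y j)) \<xi> z)"
  have mem: "op_scale (c j) (lam (y j)) \<in> alg" if "j \<in> ?J" for j
    by (rule alg_scale[OF lam_in_alg[OF y[OF that]]])
  have U: "U \<in> alg" unfolding U_def by (rule alg_sum[OF _ mem]) auto
  have "\<phi> U = (\<Sum>j\<in>?J. \<phi> (op_scale (c j) (lam (y j))))"
    unfolding U_def by (rule cstar_state_sum[OF _ mem st]) auto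
  also have "\<dots> = (\<Sum>j\<in>?J. \<phi> (lam g))"
    using st lam_in_alg[OF y] c by (intro sum.cong) (auto simp: cstar_state_def)
  finally have \<phi>U: "\<phi> U = of_nat n * \<phi> (lam g)" by simp
  have "op_norm (carrier G) U \<le> 2 * sqrt (real n)"
  proof (rule op_norm_le)
    fix \<xi> assume \<xi>: "\<xi> \<in> ell2 (carrier G)"
    let ?M = "(ell2_norm (carrier G) \<xi>)\<^sup>2"
    show "ell2_norm (carrier G) (U \<xi>) \<le> 2 * sqrt (real n) * ell2_norm (carrier G) \<xi>"
    proof (rule ell2_norm_leI(2))
      show "U \<xi> z = 0" if "z \<notin> carrier G" for z
        using that by (simp add: U_def op_scale_def lam_outside)
      fix F assume F: "finite F" "F \<subseteq> carrier G"
      have "(\<Sum>z\<in>F. (cmod (U \<xi> z))\<^sup>2) \<le> (\<Sum>z\<in>F. (\<Sum>j\<in>?J. cmod (\<xi> (inv (y j) \<otimes> z)))\<^sup>2)"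
      proof (intro sum_mono power_mono)
        fix z assume z: "z \<in> F"
        have "cmod (U \<xi> z) \<le> (\<Sum>j\<in>?J. cmod (op_scale (c j) (lam (y j)) \<xi> z))"
          unfolding U_def by (rule norm_sum)
        also have "\<dots> = (\<Sum>j\<in>?J. cmod (\<xi> (inv (y j) \<otimes> z)))"
          using z F \<xi> y c by (intro sum.cong) (auto simp: op_scale_def norm_mult cmod_lam)
        finally show "cmod (U \<xi> z) \<le> (\<Sum>j\<in>?J. cmod (\<xi> (inv (y j) \<otimes> z)))" .
      qed simp
      also have "\<dots> \<le> 4 * real (card ?J) * ?M"
        by (rule ping_pong_sum_bound[OF _ y disj _ sum_squares_le_ell2_norm[OF \<xi>] F])
          (use ping in \<open>auto simp: y_def\<close>)
      also have "\<dots> = (2 * sqrt (real n) * ell2_norm (carrier G) \<xi>)\<^sup>2"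
        by (simp add: power_mult_distrib)
      finally show "L2_set (\<lambda>z. cmod (U \<xi> z)) F \<le> 2 * sqrt (real n) * ell2_norm (carrier G) \<xi>"
        unfolding L2_set_def by (intro real_le_lsqrt) (auto intro: sum_nonneg)
    qed
  qed simp
  then have "cmod (\<phi> U) \<le> 2 * sqrt (real n)"
    using n by (intro cstar_state_contractive[OF st U]) auto
  then show ?thesis by (simp add: \<phi>U norm_mult)
qed

lemma trace_lam_eq_0:
  assumes BP: "property_BP G" and \<phi>: "tracial_state (carrier G) alg \<phi>"
    and g: "g \<in> carrier G" "g \<noteq> \<one>"
  shows "\<phi> (lam g) = 0"
proof (rule ccontr)
  define a where "a = cmod (\<phi> (lam g))"
  assume "\<phi> (lam g) \<noteq> 0"
  then have a: "a > 0" by (simp add: a_def)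
  \<comment> \<open>beyond \<open>4 / a\<^sup>2\<close> the bound \<open>n * a \<le> 2 * sqrt n\<close> fails\<close>
  obtain n :: nat where n: "real n > max 2 (4 / a\<^sup>2)" using reals_Archimedean2 by blast
  then have n2: "n \<ge> 2" "real n > 0" "real n * a\<^sup>2 > 4" using a by (auto simp: field_simps)
  have "real n * a \<le> 2 * sqrt (real n)"
    unfolding a_def by (rule trace_lam_bound[OF BP \<phi> g n2(1)])
  then have "(real n * a)\<^sup>2 \<le> (2 * sqrt (real n))\<^sup>2" using a by (intro power_mono) auto
  then have "real n * (real n * a\<^sup>2) \<le> real n * 4"
    by (simp add: power_mult_distrib) (simp add: power2_eq_square mult_ac)
  then show False using n2 by simp
qed

text \<open>
  Since a trace vanishes on \<open>lam g\<close> for \<open>g \<noteq> \<one>\<close>, it is the multiple of the canonical trace by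
  \<open>a = \<phi> (lam \<one>)\<close>.  Positivity makes \<open>a\<close> a nonnegative real, and then the norm of \<open>\<phi>\<close> is \<open>a\<close>,
  so that \<open>a = 1\<close>.
\<close>

lemma trace_eq_canonical:
  assumes BP: "property_BP G" and \<phi>: "tracial_state (carrier G) alg \<phi>"
  shows "\<phi> = canonical_trace"
proof -
  have st: "cstar_state (carrier G) alg \<phi>" using \<phi> by (simp add: tracial_state_def)
  have bf: "bounded_functional (carrier G) alg canonical_trace"
    using canonical_trace_tracial cstar_state_bounded_functional
    by (simp add: tracial_state_def)
  define a where "a = \<phi> (lam \<one>)"
  have one: "lam \<one> \<in> alg" by (simp add: lam_in_alg)
  have scaled: "bounded_functional (carrier G) alg (\<lambda>T. a * canonical_trace T)"
  proof -
    have "cmod (a * canonical_trace T) \<le> cmod a * op_norm (carrier G) T" if "T \<in> alg" for T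
      using cmod_canonical_trace_le[OF that] by (simp add: norm_mult mult_left_mono)
    then show ?thesis
      unfolding bounded_functional_def
      by (auto simp: canonical_trace_add canonical_trace_scale algebra_simps
          intro!: exI[of _ "cmod a"])
  qed
  have eq: "\<phi> T = a * canonical_trace T" if "T \<in> alg" for T
  proof (rule bounded_functional_eqI[OF lam_image_bounded
        cstar_state_bounded_functional[OF st, unfolded alg_eq] scaled[unfolded alg_eq]
        _ that[unfolded alg_eq]])
    fix R assume "R \<in> lam ` carrier G"
    then obtain g where g: "g \<in> carrier G" "R = lam g" by blast
    then show "\<phi> R = a * canonical_trace R"
      using trace_lam_eq_0[OF BP \<phi> g(1)] by (cases "g = \<one>") (auto simp: canonical_trace_lam a_def)
  qed
  have "lam \<one> \<circ> lam \<one> = lam \<one>" by (simp add: lam_comp sigma_one op_scale_def)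
  moreover have "is_adjoint (carrier G) (lam \<one>) (lam \<one>)"
    using lam_adjoint[OF one_closed] by (simp add: sigma_one op_scale_def)
  ultimately have "a \<in> \<real>\<^sub>\<ge>\<^sub>0"
    using st one unfolding cstar_state_def a_def by metis
  then have a_real: "a = of_real (cmod a)" 
    by (simp add: nonneg_Reals_cmod_eq_Re complex_nonneg_Reals_iff complex_eq_iff)
  have "cmod a \<le> 1"
    unfolding a_def by (rule cstar_state_contractive[OF st one op_norm_lam_le]) auto
  moreover have "1 \<le> cmod a"
  proof -
    have "(SUP T\<in>{T \<in> alg. op_norm (carrier G) T \<le> 1}. cmod (\<phi> T)) \<le> cmod a"
    proof (rule cSUP_least)
      show "{T \<in> alg. op_norm (carrier G) T \<le> 1} \<noteq> {}"
        using one op_norm_lam_le[OF one_closed] by blast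
      fix T assume T: "T \<in> {T \<in> alg. op_norm (carrier G) T \<le> 1}"
      then have "cmod (canonical_trace T) \<le> 1" using cmod_canonical_trace_le[of T] by auto
      then show "cmod (\<phi> T) \<le> cmod a" using T by (simp add: eq norm_mult mult_left_le)
    qed
    then show ?thesis using st by (simp add: cstar_state_def)
  qed
  ultimately have "a = 1" using a_real by (metis antisym of_real_1)
  show ?thesis
  proof (rule extensionalityI)
    show "\<phi> \<in> extensional alg" using st by (simp add: cstar_state_def)
    show "canonical_trace \<in> extensional alg" by (simp add: canonical_trace_def)
    show "\<phi> T = canonical_trace T" if "T \<in> alg" for T using eq[OF that] \<open>a = 1\<close> by simp
  qed
qed

lemma BP_unique_trace: "property_BP G \<Longrightarrow> unique_trace_property G \<sigma>"
  unfolding unique_trace_property_def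
  using canonical_trace_tracial trace_eq_canonical by blast

end

lemma ICC_imp_kleppner: "ICC G \<Longrightarrow> kleppner_condition G \<sigma>"
  by (simp add: ICC_def kleppner_condition_def)

theorem propositionB1:
  fixes G :: "('a, 'b) monoid_scheme" and \<sigma> :: "'a \<Rightarrow> 'a \<Rightarrow> complex"
  assumes "group G"
    and "property_BP G"
    and "\<sigma> \<in> cocycles2 G"
  shows "unique_trace_property G \<sigma> \<and> ICC G \<and> class_K_UT G"
proof -
  have unique: "unique_trace_property G \<tau>" if "\<tau> \<in> cocycles2 G" for \<tau>
  proof -
    interpret twisted_group G \<tau>
      using assms(1) that by (simp add: twisted_group_def twisted_group_axioms_def)
    show ?thesis by (rule BP_unique_trace[OF assms(2)])
  qed
  have "ICC G" by (rule group.property_BP_imp_ICC[OF assms(1,2)])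
  then show ?thesis
    using assms(1) unique unique[OF assms(3)] ICC_imp_kleppner by (auto simp: class_K_UT_def)
qed

end
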